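(* Let $\mathcal D$ be a triangulated category with a bounded $t$-structure $(\mathcal D^{\leq 0},\mathcal D^{\geq 0})$ and let $d\geq 1$. There is a bijection between \begin{itemize} \item the set of $d$-FAE closed subcategories of $\mathcal D^{[-d+1,0]}$, and \item the set of suspended subcategories $\mathcal C$ of $\mathcal D$ satisfying $\mathcal D^{\leq -d}\subseteq\mathcal C\subseteq\mathcal D^{\leq 0}$, \end{itemize} given by the map $\mathcal X\mapsto\mathcal D^{\leq -d}*\mathcal X$, with inverse $\mathcal C\mapsto\mathcal C\cap\mathcal D^{[-d+1,0]}$.
   Context: All subcategories are full, closed under isomorphisms and contain the zero object. $\mathcal D^{\leq n}=\mathcal D^{\leq 0}[-n]$, $\mathcal D^{\geq m}=\mathcal D^{\geq 0}[-m]$, $\mathcal D^{[m,n]}=\mathcal D^{\leq n}\cap\mathcal D^{\geq m}$. For subcategories $\mathcal A,\mathcal B$ of $\mathcal D$, $\mathcal A*\mathcal B$ consists of the objects $Z$ fitting in a triangle $A\to Z\to B\to A[1]$ with $A\in\mathcal A$, $B\in\mathcal B$; $\mathcal X$ is closed under extensions if $\mathcal X*\mathcal X\subseteq\mathcal X$. A subcategory of $\mathcal D$ is suspended if it is closed under extensions and positive shifts. For $\mathcal X\subseteq\mathcal D^{[-d+1,0]}$, an object $Z\in\mathcal D^{[-d+1,0]}$ is a $d$-factor of $\mathcal X$ if there exist $d$ triangles $Z_i\to X_i\to Z_{i-1}\to Z_i[1]$, $1\leq i\leq d$, with $Z_0=Z$, $Z_1,\dots,Z_d\in\mathcal D^{[-d+1,0]}$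 and $X_1,\dots,X_d\in\mathcal X$. $\mathcal X$ is $d$-FAE closed if it contains all its $d$-factors and is closed under extensions. *)

theory Defs
  imports "HOL-Algebra.Group"
begin

section \<open>Additive categories\<close>

text \<open>
  One record carries all the data of a triangulated category. \<open>Add\<close> is the addition of parallel
  arrows, \<open>ShO\<close> and \<open>ShA\<close> are the shift functor \<open>[1]\<close> on objects and on arrows, and a
  triangle \<open>X \<rightarrow> Y \<rightarrow> Z \<rightarrow> X[1]\<close> is stored in \<open>Tri\<close> as the triple of its arrows, which determine
  its objects.
\<close>

record ('o, 'a) tricat =
  Obj :: "'o set"
  Arr :: "'a set"
  Dom :: "'a \<Rightarrow> 'o"
  Cod :: "'a \<Rightarrow> 'o"
  Id :: "'o \<Rightarrow> 'a"
  Comp :: "'a \<Rightarrow> 'a \<Rightarrow> 'a"  (infixl \<open>\<cdot>\<index>\<close> 70)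
  Add :: "'a \<Rightarrow> 'a \<Rightarrow> 'a"
  Zero :: "'o \<Rightarrow> 'o \<Rightarrow> 'a"
  ShO :: "'o \<Rightarrow> 'o"
  ShA :: "'a \<Rightarrow> 'a"
  Tri :: "('a \<times> 'a \<times> 'a) set"

definition Hom :: "('o, 'a) tricat \<Rightarrow> 'o \<Rightarrow> 'o \<Rightarrow> 'a set" where
  "Hom D X Y = {f \<in> Arr D. Dom D f = X \<and> Cod D f = Y}"

text \<open>The additive group \<open>Hom(X, Y)\<close>, written multiplicatively because of HOL-Algebra.\<close>

definition Hom_group :: "('o, 'a) tricat \<Rightarrow> 'o \<Rightarrow> 'o \<Rightarrow> 'a monoid" where
  "Hom_group D X Y = \<lparr>carrier = Hom D X Y, mult = Add D, one = Zero D X Y\<rparr>"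

definition Neg :: "('o, 'a) tricat \<Rightarrow> 'a \<Rightarrow> 'a" where
  "Neg D f = inv\<^bsub>Hom_group D (Dom D f) (Cod D f)\<^esub> f"

definition zero_object :: "('o, 'a) tricat \<Rightarrow> 'o \<Rightarrow> bool" where
  "zero_object D Z \<longleftrightarrow> Z \<in> Obj D \<and>
     (\<forall>X \<in> Obj D. (\<exists>!f. f \<in> Hom D X Z) \<and> (\<exists>!f. f \<in> Hom D Z X))"

definition iso_arrow :: "('o, 'a) tricat \<Rightarrow> 'o \<Rightarrow> 'o \<Rightarrow> 'a \<Rightarrow> bool" where
  "iso_arrow D X Y f \<longleftrightarrow> f \<in> Hom D X Y \<and>
     (\<exists>g \<in> Hom D Y X. g \<cdot>\<^bsub>D\<^esub> f = Id D X \<and> f \<cdot>\<^bsub>D\<^esub> g = Id D Y)"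

definition iso_objects :: "('o, 'a) tricat \<Rightarrow> 'o \<Rightarrow> 'o \<Rightarrow> bool" where
  "iso_objects D X Y \<longleftrightarrow> (\<exists>f. iso_arrow D X Y f)"

definition biproduct ::
  "('o, 'a) tricat \<Rightarrow> 'o \<Rightarrow> 'o \<Rightarrow> 'o \<Rightarrow> 'a \<Rightarrow> 'a \<Rightarrow> 'a \<Rightarrow> 'a \<Rightarrow> bool" where
  "biproduct D X Y P i j p q \<longleftrightarrow> P \<in> Obj D \<and>
     i \<in> Hom D X P \<and> j \<in> Hom D Y P \<and> p \<in> Hom D P X \<and> q \<in> Hom D P Y \<and>
     p \<cdot>\<^bsub>D\<^esub> i = Id D X \<and> q \<cdot>\<^bsub>D\<^esub> j = Id D Y \<and>
     p \<cdot>\<^bsub>D\<^esub> j = Zero D Y X \<and> q \<cdot>\<^bsub>D\<^esub> i = Zero D X Y \<and>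
     Add D (i \<cdot>\<^bsub>D\<^esub> p) (j \<cdot>\<^bsub>D\<^esub> q) = Id D P"

locale cat =
  fixes D :: "('o, 'a) tricat" (structure)
  assumes Dom_in_Obj: "f \<in> Arr D \<Longrightarrow> Dom D f \<in> Obj D"
    and Cod_in_Obj: "f \<in> Arr D \<Longrightarrow> Cod D f \<in> Obj D"
    and Id_in_Hom: "X \<in> Obj D \<Longrightarrow> Id D X \<in> Hom D X X"
    and Comp_in_Hom: "\<lbrakk>f \<in> Hom D X Y; g \<in> Hom D Y Z\<rbrakk> \<Longrightarrow> g \<cdot> f \<in> Hom D X Z"
    and Comp_Id: "f \<in> Hom D X Y \<Longrightarrow> f \<cdot> Id D X = f"
    and Id_Comp: "f \<in> Hom D X Y \<Longrightarrow> Id D Y \<cdot> f = f"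
    and Comp_assoc:
      "\<lbrakk>f \<in> Hom D W X; g \<in> Hom D X Y; h \<in> Hom D Y Z\<rbrakk> \<Longrightarrow> (h \<cdot> g) \<cdot> f = h \<cdot> (g \<cdot> f)"

locale additive_cat = cat +
  assumes Hom_comm_group: "\<lbrakk>X \<in> Obj D; Y \<in> Obj D\<rbrakk> \<Longrightarrow> comm_group (Hom_group D X Y)"
    and Comp_Add_left: "\<lbrakk>f \<in> Hom D X Y; g \<in> Hom D Y Z; g' \<in> Hom D Y Z\<rbrakk> \<Longrightarrow>
      Add D g g' \<cdot> f = Add D (g \<cdot> f) (g' \<cdot> f)"
    and Comp_Add_right: "\<lbrakk>f \<in> Hom D X Y; f' \<in> Hom D X Y; g \<in> Hom D Y Z\<rbrakk> \<Longrightarrow>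
      g \<cdot> Add D f f' = Add D (g \<cdot> f) (g \<cdot> f')"
    and ex_zero_object: "\<exists>Z. zero_object D Z"
    and ex_biproduct: "\<lbrakk>X \<in> Obj D; Y \<in> Obj D\<rbrakk> \<Longrightarrow> \<exists>P i j p q. biproduct D X Y P i j p q"


section \<open>Triangulated categories\<close>

definition triangle :: "('o, 'a) tricat \<Rightarrow> 'o \<Rightarrow> 'o \<Rightarrow> 'o \<Rightarrow> 'a \<Rightarrow> 'a \<Rightarrow> 'a \<Rightarrow> bool" where
  "triangle D X Y Z f g h \<longleftrightarrow>
     f \<in> Hom D X Y \<and> g \<in> Hom D Y Z \<and> h \<in> Hom D Z (ShO D X) \<and> (f, g, h) \<in> Tri D"

text \<open>
  The shift functor is only required to be an additive autoequivalence, that is, fully faithful and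
  essentially surjective; automorphisms of categories are a special case.
\<close>

locale triangulated_cat = additive_cat +
  assumes ShO_in_Obj: "X \<in> Obj D \<Longrightarrow> ShO D X \<in> Obj D"
    and ShA_Id: "X \<in> Obj D \<Longrightarrow> ShA D (Id D X) = Id D (ShO D X)"
    and ShA_Comp: "\<lbrakk>f \<in> Hom D X Y; g \<in> Hom D Y Z\<rbrakk> \<Longrightarrow> ShA D (g \<cdot> f) = ShA D g \<cdot> ShA D f"
    and ShA_Add: "\<lbrakk>f \<in> Hom D X Y; g \<in> Hom D X Y\<rbrakk> \<Longrightarrow>
      ShA D (Add D f g) = Add D (ShA D f) (ShA D g)"
    and ShA_fully_faithful: "\<lbrakk>X \<in> Obj D; Y \<in> Obj D\<rbrakk> \<Longrightarrow>
      bij_betw (ShA D) (Hom D X Y) (Hom D (ShO D X) (ShO D Y))"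
    and Sh_ess_surj: "Y \<in> Obj D \<Longrightarrow> \<exists>X \<in> Obj D. iso_objects D (ShO D X) Y"
    and Tri_iso: "\<lbrakk>triangle D X Y Z f g h;
      f' \<in> Hom D X' Y'; g' \<in> Hom D Y' Z'; h' \<in> Hom D Z' (ShO D X');
      iso_arrow D X X' a; iso_arrow D Y Y' b; iso_arrow D Z Z' c;
      b \<cdot> f = f' \<cdot> a; c \<cdot> g = g' \<cdot> b; ShA D a \<cdot> h = h' \<cdot> c\<rbrakk> \<Longrightarrow>
      triangle D X' Y' Z' f' g' h'"
    and Tri_Id: "\<lbrakk>X \<in> Obj D; zero_object D Z\<rbrakk> \<Longrightarrow>
      triangle D X X Z (Id D X) (Zero D X Z) (Zero D Z (ShO D X))"
    and Tri_cone: "f \<in> Hom D X Y \<Longrightarrow> \<exists>Z g h. triangle D X Y Z f g h"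
    and Tri_rotate: "\<lbrakk>f \<in> Hom D X Y; g \<in> Hom D Y Z; h \<in> Hom D Z (ShO D X)\<rbrakk> \<Longrightarrow>
      triangle D X Y Z f g h \<longleftrightarrow> triangle D Y Z (ShO D X) g h (Neg D (ShA D f))"
    and Tri_morphism: "\<lbrakk>triangle D X Y Z f g h; triangle D X' Y' Z' f' g' h';
      a \<in> Hom D X X'; b \<in> Hom D Y Y'; b \<cdot> f = f' \<cdot> a\<rbrakk> \<Longrightarrow>
      \<exists>c \<in> Hom D Z Z'. c \<cdot> g = g' \<cdot> b \<and> ShA D a \<cdot> h = h' \<cdot> c"
    and Tri_octahedral: "\<lbrakk>triangle D X Y Z' f f1 f2; triangle D Y Z X' g g1 g2;
      triangle D X Z Y' (g \<cdot> f) k1 k2\<rbrakk> \<Longrightarrow>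
      \<exists>u v w. triangle D Z' Y' X' u v w \<and>
        u \<cdot> f1 = k1 \<cdot> g \<and> k2 \<cdot> u = f2 \<and>
        v \<cdot> k1 = g1 \<and> g2 \<cdot> v = ShA D f \<cdot> k2 \<and>
        w = ShA D f1 \<cdot> g2"


section \<open>Subcategories and t-structures\<close>

text \<open>Full subcategories are given by their sets of objects.\<close>

definition subcat :: "('o, 'a) tricat \<Rightarrow> 'o set \<Rightarrow> bool" where
  "subcat D A \<longleftrightarrow> A \<subseteq> Obj D \<and>
     (\<forall>X \<in> A. \<forall>Y \<in> Obj D. iso_objects D X Y \<longrightarrow> Y \<in> A) \<and>
     (\<exists>Z \<in> A. zero_object D Z)"

text \<open>
  The subcategory \<open>A[n]\<close>, closed under isomorphisms. Since the shift is only an autoequivalence,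
  \<open>Y \<cong> X[n]\<close> is expressed without a quasi-inverse: as \<open>Y \<cong> X[n]\<close> if \<open>n \<ge> 0\<close> and as \<open>Y[-n] \<cong> X\<close> if
  \<open>n \<le> 0\<close>. One of the two exponents below is always 0.
\<close>

definition shift_sub :: "('o, 'a) tricat \<Rightarrow> 'o set \<Rightarrow> int \<Rightarrow> 'o set" where
  "shift_sub D A n = {Y \<in> Obj D. \<exists>X \<in> A.
     iso_objects D ((ShO D ^^ nat (- n)) Y) ((ShO D ^^ nat n) X)}"

definition ext_prod :: "('o, 'a) tricat \<Rightarrow> 'o set \<Rightarrow> 'o set \<Rightarrow> 'o set" where
  "ext_prod D A B = {Z \<in> Obj D. \<exists>X \<in> A. \<exists>Y \<in> B. \<exists>f g h. triangle D X Z Y f g h}"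

definition ext_closed :: "('o, 'a) tricat \<Rightarrow> 'o set \<Rightarrow> bool" where
  "ext_closed D A \<longleftrightarrow> ext_prod D A A \<subseteq> A"

definition suspended :: "('o, 'a) tricat \<Rightarrow> 'o set \<Rightarrow> bool" where
  "suspended D C \<longleftrightarrow> subcat D C \<and> ext_closed D C \<and> (\<forall>n > 0. shift_sub D C n \<subseteq> C)"

text \<open>
  \<open>U\<close> and \<open>V\<close> always stand for the two subcategories \<open>D\<^sup>\<le>\<^sup>0\<close> and \<open>D\<^sup>\<ge>\<^sup>0\<close>. Both \<open>D\<^sup>\<le>\<^sup>n = U[-n]\<close> and
  \<open>D\<^sup>\<ge>\<^sup>m = V[-m]\<close> are instances of \<open>trunc\<close>.
\<close>

definition trunc :: "('o, 'a) tricat \<Rightarrow> 'o set \<Rightarrow> int \<Rightarrow> 'o set" where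
  "trunc D A n = shift_sub D A (- n)"

definition t_interval :: "('o, 'a) tricat \<Rightarrow> 'o set \<Rightarrow> 'o set \<Rightarrow> int \<Rightarrow> int \<Rightarrow> 'o set" where
  "t_interval D U V m n = trunc D U n \<inter> trunc D V m"

definition t_structure :: "('o, 'a) tricat \<Rightarrow> 'o set \<Rightarrow> 'o set \<Rightarrow> bool" where
  "t_structure D U V \<longleftrightarrow> subcat D U \<and> subcat D V \<and>
     trunc D U (-1) \<subseteq> U \<and> trunc D V 1 \<subseteq> V \<and>
     (\<forall>X \<in> U. \<forall>Y \<in> trunc D V 1. Hom D X Y = {Zero D X Y}) \<and>
     ext_prod D U (trunc D V 1) = Obj D"

definition bounded_t_structure :: "('o, 'a) tricat \<Rightarrow> 'o set \<Rightarrow> 'o set \<Rightarrow> bool" where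
  "bounded_t_structure D U V \<longleftrightarrow> t_structure D U V \<and>
     (\<forall>X \<in> Obj D. \<exists>m n. X \<in> t_interval D U V m n)"


section \<open>d-factors\<close>

definition d_factor ::
  "('o, 'a) tricat \<Rightarrow> 'o set \<Rightarrow> 'o set \<Rightarrow> nat \<Rightarrow> 'o set \<Rightarrow> 'o \<Rightarrow> bool" where
  "d_factor D U V d \<X> Z \<longleftrightarrow> Z \<in> t_interval D U V (- int d + 1) 0 \<and>
     (\<exists>Zs Xs. Zs 0 = Z \<and>
       (\<forall>i \<in> {1..d}. Zs i \<in> t_interval D U V (- int d + 1) 0 \<and> Xs i \<in> \<X> \<and>
         (\<exists>f g h. triangle D (Zs i) (Xs i) (Zs (i - 1)) f g h)))"

definition d_FAE_closed ::
  "('o, 'a) tricat \<Rightarrow> 'o set \<Rightarrow> 'o set \<Rightarrow> nat \<Rightarrow> 'o set \<Rightarrow> bool" where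
  "d_FAE_closed D U V d \<X> \<longleftrightarrow> subcat D \<X> \<and> \<X> \<subseteq> t_interval D U V (- int d + 1) 0 \<and>
     (\<forall>Z. d_factor D U V d \<X> Z \<longrightarrow> Z \<in> \<X>) \<and> ext_closed D \<X>"

end

theory Submission
  imports Defs
begin

text \<open>
  Write \<open>D\<^sup>\<le>\<^sup>n\<close>, \<open>D\<^sup>\<ge>\<^sup>n\<close> for the subcategories defined by the t-structure and \<open>I\<close> for the
  interval between \<open>-d + 1\<close> and \<open>0\<close>. Every object of a subcategory \<open>\<C>\<close> as in the statement sits in a
  triangle \<open>T \<rightarrow> Z \<rightarrow> W \<rightarrow> T[1]\<close> with \<open>T\<close> in \<open>D\<^sup>\<le>\<^sup>-\<^sup>d\<close> and \<open>W\<close> in \<open>D\<^sup>\<ge>\<^sup>-\<^sup>d\<^sup>+\<^sup>1\<close>. Since \<open>\<C>\<close>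
  contains \<open>Z\<close> and \<open>T[1]\<close>, it contains \<open>W\<close>, so \<open>\<C>\<close> is recovered from \<open>\<C> \<inter> I\<close>
  (\<open>ext_prod_Int_eq\<close>). Conversely, in a triangle \<open>T \<rightarrow> Z \<rightarrow> X \<rightarrow> T[1]\<close> with \<open>X\<close> and \<open>Z\<close> in \<open>I\<close>
  the object \<open>T\<close> is forced into \<open>D\<^sup>\<ge>\<^sup>-\<^sup>d\<^sup>+\<^sup>1\<close>, hence is zero, and \<open>Z \<cong> X\<close>
  (\<open>Int_ext_prod_eq\<close>). So both composites are identities, and what has to be shown is that the two
  maps land in the right sets.

  The intersection \<open>\<C> \<inter> I\<close> contains its d-factors because the last object \<open>Z\<^sub>d\<close> of a chain
  satisfies \<open>Z\<^sub>d[d] \<in> D\<^sup>\<le>\<^sup>-\<^sup>d \<subseteq> \<C>\<close>, and rotating the triangles carries membership of \<open>Z\<^sub>i[i]\<close> in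
  \<open>\<C>\<close> down to \<open>Z\<^sub>0 = Z\<close> (\<open>iterated_factor_shift_mem\<close>).

  The crux is that \<open>D\<^sup>\<le>\<^sup>-\<^sup>d * \<X>\<close> is suspended for a d-FAE closed \<open>\<X>\<close>. As the operation \<open>*\<close> is
  associative, extension closure reduces to \<open>\<X> * D\<^sup>\<le>\<^sup>-\<^sup>d \<subseteq> D\<^sup>\<le>\<^sup>-\<^sup>d * \<X>\<close>, and closure under shifts
  to \<open>\<X>[1] \<subseteq> D\<^sup>\<le>\<^sup>-\<^sup>d * \<X>\<close>. In both cases one truncates the given object at \<open>-d\<close> and shows that the
  upper part \<open>W\<close> is a d-factor of \<open>\<X>\<close>. This works because, after one or two triangles, the chain
  either has ended or reaches an object \<open>K\<close> concentrated in the single degree \<open>-d + 1\<close>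
  (\<open>fibre_iterated_factor\<close>), and from there it can be continued with middle terms zero:
  the shifts \<open>K[-1], K[-2], \<dots>\<close> stay in \<open>I\<close> until they reach degree \<open>0\<close>
  (\<open>iterated_factor_of_aisle\<close>).
\<close>


section \<open>Hom groups and zero objects\<close>

context additive_cat
begin

lemma Hom_Obj: assumes "f \<in> Hom D X Y" shows "X \<in> Obj D" "Y \<in> Obj D"
  using assms Dom_in_Obj Cod_in_Obj by (auto simp: Hom_def)

lemma Zero_in_Hom [simp, intro]:
  assumes "X \<in> Obj D" "Y \<in> Obj D" shows "Zero D X Y \<in> Hom D X Y"
proof -
  interpret G: comm_group "Hom_group D X Y" using Hom_comm_group[OF assms] .
  show ?thesis using G.one_closed by (simp add: Hom_group_def)
qed

lemma idem_imp_Zero: assumes "f \<in> Hom D X Y" "Add D f f = f" shows "f = Zero D X Y"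
proof -
  interpret G: comm_group "Hom_group D X Y" using Hom_comm_group Hom_Obj[OF assms(1)] by blast
  show ?thesis using G.l_cancel_one[of f f] assms by (simp add: Hom_group_def)
qed

lemma Add_Zero_Zero: assumes "X \<in> Obj D" "Y \<in> Obj D"
  shows "Add D (Zero D X Y) (Zero D X Y) = Zero D X Y"
proof -
  interpret G: comm_group "Hom_group D X Y" using Hom_comm_group[OF assms] .
  show ?thesis using G.l_one[OF G.one_closed] by (simp add: Hom_group_def)
qed

lemma Comp_Zero: assumes "g \<in> Hom D Y Z" "X \<in> Obj D"
  shows "g \<cdot> Zero D X Y = Zero D X Z"
proof (rule idem_imp_Zero)
  have z: "Zero D X Y \<in> Hom D X Y" using assms Hom_Obj by blast
  show "g \<cdot> Zero D X Y \<in> Hom D X Z" using Comp_in_Hom[OF z assms(1)] .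
  show "Add D (g \<cdot> Zero D X Y) (g \<cdot> Zero D X Y) = g \<cdot> Zero D X Y"
    using Comp_Add_right[OF z z assms(1)] Add_Zero_Zero[OF assms(2) Hom_Obj(1)[OF assms(1)]]
    by simp
qed

lemma Zero_Comp: assumes "f \<in> Hom D X Y" "Z \<in> Obj D"
  shows "Zero D Y Z \<cdot> f = Zero D X Z"
proof (rule idem_imp_Zero)
  have z: "Zero D Y Z \<in> Hom D Y Z" using assms Hom_Obj by blast
  show "Zero D Y Z \<cdot> f \<in> Hom D X Z" using Comp_in_Hom[OF assms(1) z] .
  show "Add D (Zero D Y Z \<cdot> f) (Zero D Y Z \<cdot> f) = Zero D Y Z \<cdot> f"
    using Comp_Add_left[OF assms(1) z z] Add_Zero_Zero[OF Hom_Obj(2)[OF assms(1)] assms(2)]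
    by simp
qed

lemma Neg_in_Hom: assumes "f \<in> Hom D X Y" shows "Neg D f \<in> Hom D X Y"
proof -
  interpret G: comm_group "Hom_group D X Y" using Hom_comm_group Hom_Obj[OF assms(1)] by blast
  show ?thesis using G.inv_closed[of f] assms by (simp add: Hom_group_def Neg_def Hom_def)
qed

lemma Neg_Neg: assumes "f \<in> Hom D X Y" shows "Neg D (Neg D f) = f"
proof -
  interpret G: comm_group "Hom_group D X Y" using Hom_comm_group Hom_Obj[OF assms(1)] by blast
  have "Neg D g = inv\<^bsub>Hom_group D X Y\<^esub> g" if "g \<in> Hom D X Y" for g
    using that by (simp add: Neg_def Hom_def)
  then show ?thesis using G.inv_inv[of f] Neg_in_Hom[OF assms] assms by (simp add: Hom_group_def)
qed

lemma Neg_unique: assumes "f \<in> Hom D X Y" "g \<in> Hom D X Y" "Add D f g = Zero D X Y"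
  shows "f = Neg D g"
proof -
  interpret G: comm_group "Hom_group D X Y" using Hom_comm_group Hom_Obj[OF assms(1)] by blast
  show ?thesis using G.inv_equality[of f g] assms by (simp add: Hom_group_def Neg_def Hom_def)
qed

lemma Add_Neg: assumes "f \<in> Hom D X Y" shows "Add D (Neg D f) f = Zero D X Y"
proof -
  interpret G: comm_group "Hom_group D X Y" using Hom_comm_group Hom_Obj[OF assms(1)] by blast
  show ?thesis using G.l_inv[of f] assms by (simp add: Hom_group_def Neg_def Hom_def)
qed

lemma Neg_Zero: assumes "X \<in> Obj D" "Y \<in> Obj D" shows "Neg D (Zero D X Y) = Zero D X Y"
  using Neg_unique[OF _ _ Add_Zero_Zero] assms by simp

lemma Comp_Neg: assumes "f \<in> Hom D X Y" "g \<in> Hom D Y Z"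
  shows "g \<cdot> Neg D f = Neg D (g \<cdot> f)"
proof (rule Neg_unique)
  show "g \<cdot> Neg D f \<in> Hom D X Z" "g \<cdot> f \<in> Hom D X Z"
    using assms Neg_in_Hom Comp_in_Hom by blast+
  show "Add D (g \<cdot> Neg D f) (g \<cdot> f) = Zero D X Z"
    using Comp_Add_right[OF Neg_in_Hom[OF assms(1)] assms] Add_Neg[OF assms(1)]
      Comp_Zero[OF assms(2) Hom_Obj(1)[OF assms(1)]] by simp
qed

lemma Neg_Comp: assumes "f \<in> Hom D X Y" "g \<in> Hom D Y Z"
  shows "Neg D g \<cdot> f = Neg D (g \<cdot> f)"
proof (rule Neg_unique)
  show "Neg D g \<cdot> f \<in> Hom D X Z" "g \<cdot> f \<in> Hom D X Z"
    using assms Neg_in_Hom Comp_in_Hom by blast+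
  show "Add D (Neg D g \<cdot> f) (g \<cdot> f) = Zero D X Z"
    using Comp_Add_left[OF assms(1) Neg_in_Hom[OF assms(2)] assms(2)] Add_Neg[OF assms(2)]
      Zero_Comp[OF assms(1) Hom_Obj(2)[OF assms(2)]] by simp
qed

text \<open>An equation between arrows, unlike the universal property, is visibly preserved by the shift.\<close>

lemma zero_object_iff_Id: "zero_object D Z \<longleftrightarrow> Z \<in> Obj D \<and> Id D Z = Zero D Z Z"
proof
  assume z: "zero_object D Z"
  then have "Z \<in> Obj D" by (simp add: zero_object_def)
  then show "Z \<in> Obj D \<and> Id D Z = Zero D Z Z"
    using z Id_in_Hom Zero_in_Hom unfolding zero_object_def by blast
next
  assume z: "Z \<in> Obj D \<and> Id D Z = Zero D Z Z"
  have "f = Zero D X Z" if "f \<in> Hom D X Z" for f X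
    using Id_Comp[OF that] Zero_Comp[OF that] z by simp
  moreover have "f = Zero D Z X" if "f \<in> Hom D Z X" for f X
    using Comp_Id[OF that] Comp_Zero[OF that] z by simp
  ultimately show "zero_object D Z"
    unfolding zero_object_def using z Zero_in_Hom by metis
qed

lemma zero_object_Obj: "zero_object D Z \<Longrightarrow> Z \<in> Obj D"
  by (simp add: zero_object_def)

lemma iso_refl: "X \<in> Obj D \<Longrightarrow> iso_objects D X X"
  unfolding iso_objects_def iso_arrow_def using Id_in_Hom Id_Comp by blast

lemma iso_sym: "iso_objects D X Y \<Longrightarrow> iso_objects D Y X"
  unfolding iso_objects_def iso_arrow_def by blast

lemma iso_Obj: assumes "iso_objects D X Y" shows "X \<in> Obj D" "Y \<in> Obj D"
  using assms Hom_Obj unfolding iso_objects_def iso_arrow_def by blast+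

lemma iso_trans: assumes "iso_objects D X Y" "iso_objects D Y Z" shows "iso_objects D X Z"
proof -
  obtain f f' where f: "f \<in> Hom D X Y" "f' \<in> Hom D Y X" "f' \<cdot> f = Id D X" "f \<cdot> f' = Id D Y"
    using assms unfolding iso_objects_def iso_arrow_def by blast
  obtain g g' where g: "g \<in> Hom D Y Z" "g' \<in> Hom D Z Y" "g' \<cdot> g = Id D Y" "g \<cdot> g' = Id D Z"
    using assms unfolding iso_objects_def iso_arrow_def by blast
  have gf: "g \<cdot> f \<in> Hom D X Z" and fg: "f' \<cdot> g' \<in> Hom D Z X"
    using f g Comp_in_Hom by blast+
  have "(f' \<cdot> g') \<cdot> (g \<cdot> f) = Id D X"
    using Comp_assoc[OF gf g(2) f(2)] Comp_assoc[OF f(1) g(1,2)] f(3) g(3) Id_Comp[OF f(1)] by simp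
  moreover have "(g \<cdot> f) \<cdot> (f' \<cdot> g') = Id D Z"
    using Comp_assoc[OF fg f(1) g(1)] Comp_assoc[OF g(2) f(2,1)] f(4) g(4) Id_Comp[OF g(2)] by simp
  ultimately have "iso_arrow D X Z (g \<cdot> f)"
    unfolding iso_arrow_def using gf fg by blast
  then show ?thesis unfolding iso_objects_def by blast
qed

lemma zero_objects_iso: assumes "zero_object D X" "zero_object D Y" shows "iso_objects D X Y"
proof -
  have "Zero D X Y \<in> Hom D X Y" "Zero D Y X \<in> Hom D Y X"
    using assms by (auto simp: zero_object_def)
  moreover have "Zero D Y X \<cdot> Zero D X Y = Id D X" "Zero D X Y \<cdot> Zero D Y X = Id D Y"
    using assms Zero_Comp calculation by (auto simp: zero_object_iff_Id)
  ultimately show ?thesis unfolding iso_objects_def iso_arrow_def by blast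
qed

lemma Hom_zero_iso:
  assumes X: "iso_objects D X X'" and Y: "iso_objects D Y Y'"
    and zero: "Hom D X Y = {Zero D X Y}"
  shows "Hom D X' Y' = {Zero D X' Y'}"
proof -
  obtain f f' where f: "f \<in> Hom D X X'" "f' \<in> Hom D X' X" "f \<cdot> f' = Id D X'"
    using X unfolding iso_objects_def iso_arrow_def by blast
  obtain g g' where g: "g \<in> Hom D Y Y'" "g' \<in> Hom D Y' Y" "g \<cdot> g' = Id D Y'"
    using Y unfolding iso_objects_def iso_arrow_def by blast
  have "u = Zero D X' Y'" if u: "u \<in> Hom D X' Y'" for u
  proof -
    have uf: "u \<cdot> f \<in> Hom D X Y'" using u f Comp_in_Hom by blast
    have "g' \<cdot> (u \<cdot> f) = Zero D X Y" using Comp_in_Hom[OF uf g(2)] zero by blast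
    then have "u \<cdot> f = Zero D X Y'"
      using Comp_assoc[OF uf g(2) g(1)] g(3) Id_Comp[OF uf] Comp_Zero[OF g(1)] iso_Obj[OF X]
      by simp
    then show ?thesis
      using Comp_assoc[OF f(2) f(1) u] f(3) Comp_Id[OF u] Zero_Comp[OF f(2)] iso_Obj[OF Y]
      by simp
  qed
  then show ?thesis using iso_Obj[OF X] iso_Obj[OF Y] by blast
qed

lemma subcat_iso: "\<lbrakk>subcat D A; X \<in> A; iso_objects D X Y\<rbrakk> \<Longrightarrow> Y \<in> A"
  unfolding subcat_def using iso_Obj by blast

lemma subcat_zero: "\<lbrakk>subcat D A; zero_object D Z\<rbrakk> \<Longrightarrow> Z \<in> A"
  using subcat_iso zero_objects_iso unfolding subcat_def by blast

end


section \<open>Shifts and triangles on objects\<close>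

text \<open>Beyond the axioms and exactness of \<open>Hom\<close>, the argument only sees which objects share a triangle.\<close>

definition tri :: "('o, 'a) tricat \<Rightarrow> 'o \<Rightarrow> 'o \<Rightarrow> 'o \<Rightarrow> bool" where
  "tri D X Y Z \<longleftrightarrow> (\<exists>f g h. triangle D X Y Z f g h)"

context triangulated_cat
begin

lemma ShA_in_Hom: "f \<in> Hom D X Y \<Longrightarrow> ShA D f \<in> Hom D (ShO D X) (ShO D Y)"
  using ShA_fully_faithful[of X Y] Hom_Obj[of f X Y] bij_betwE by blast

lemma ShA_full: "\<lbrakk>g \<in> Hom D (ShO D X) (ShO D Y); X \<in> Obj D; Y \<in> Obj D\<rbrakk> \<Longrightarrow>
    \<exists>f \<in> Hom D X Y. ShA D f = g"
  using ShA_fully_faithful[of X Y] unfolding bij_betw_def by (metis imageE)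

lemma ShA_faithful: "\<lbrakk>f \<in> Hom D X Y; g \<in> Hom D X Y; ShA D f = ShA D g\<rbrakk> \<Longrightarrow> f = g"
  using ShA_fully_faithful[of X Y] Hom_Obj[of f X Y] unfolding bij_betw_def inj_on_def by blast

lemma ShA_Zero: assumes "X \<in> Obj D" "Y \<in> Obj D"
  shows "ShA D (Zero D X Y) = Zero D (ShO D X) (ShO D Y)"
  using idem_imp_Zero ShA_Add[of "Zero D X Y" X Y "Zero D X Y"] Add_Zero_Zero ShA_in_Hom assms
  by (metis Zero_in_Hom)

lemma zero_object_shift: "zero_object D Z \<Longrightarrow> zero_object D (ShO D Z)"
  unfolding zero_object_iff_Id using ShA_Id ShA_Zero ShO_in_Obj by metis

lemma iso_shift_iff: assumes "X \<in> Obj D" "Y \<in> Obj D"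
  shows "iso_objects D (ShO D X) (ShO D Y) \<longleftrightarrow> iso_objects D X Y"
proof
  assume "iso_objects D (ShO D X) (ShO D Y)"
  then obtain f' g' where *: "f' \<in> Hom D (ShO D X) (ShO D Y)" "g' \<in> Hom D (ShO D Y) (ShO D X)"
      "g' \<cdot> f' = Id D (ShO D X)" "f' \<cdot> g' = Id D (ShO D Y)"
    unfolding iso_objects_def iso_arrow_def by blast
  obtain f g where f: "f \<in> Hom D X Y" "ShA D f = f'" and g: "g \<in> Hom D Y X" "ShA D g = g'"
    using ShA_full * assms by meson
  have "g \<cdot> f = Id D X"
    using ShA_faithful[OF Comp_in_Hom[OF f(1) g(1)] Id_in_Hom] ShA_Comp[OF f(1) g(1)] ShA_Id *
      assms f g by simp
  moreover have "f \<cdot> g = Id D Y"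
    using ShA_faithful[OF Comp_in_Hom[OF g(1) f(1)] Id_in_Hom] ShA_Comp[OF g(1) f(1)] ShA_Id *
      assms f g by simp
  ultimately show "iso_objects D X Y" unfolding iso_objects_def iso_arrow_def using f g by blast
next
  assume "iso_objects D X Y"
  then obtain f g where "f \<in> Hom D X Y" "g \<in> Hom D Y X" "g \<cdot> f = Id D X" "f \<cdot> g = Id D Y"
    unfolding iso_objects_def iso_arrow_def by blast
  then show "iso_objects D (ShO D X) (ShO D Y)"
    unfolding iso_objects_def iso_arrow_def using ShA_in_Hom ShA_Comp ShA_Id assms by metis
qed

lemma Hom_zero_shift_iff: assumes "X \<in> Obj D" "Y \<in> Obj D"
  shows "Hom D (ShO D X) (ShO D Y) = {Zero D (ShO D X) (ShO D Y)} \<longleftrightarrow> Hom D X Y = {Zero D X Y}"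
proof
  assume l: "Hom D (ShO D X) (ShO D Y) = {Zero D (ShO D X) (ShO D Y)}"
  have "f = Zero D X Y" if "f \<in> Hom D X Y" for f
    using ShA_faithful[OF that Zero_in_Hom[OF assms]] ShA_in_Hom[OF that] l ShA_Zero[OF assms]
    by simp
  then show "Hom D X Y = {Zero D X Y}" using assms by blast
next
  assume "Hom D X Y = {Zero D X Y}"
  then show "Hom D (ShO D X) (ShO D Y) = {Zero D (ShO D X) (ShO D Y)}"
    using ShA_fully_faithful[OF assms] ShA_Zero[OF assms] by (simp add: bij_betw_def)
qed

lemma shift_pow_Obj: "X \<in> Obj D \<Longrightarrow> (ShO D ^^ n) X \<in> Obj D"
  by (induction n) (auto simp: ShO_in_Obj)

lemma iso_shift_pow: "iso_objects D X Y \<Longrightarrow> iso_objects D ((ShO D ^^ n) X) ((ShO D ^^ n) Y)"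
  by (induction n) (auto simp: iso_shift_iff iso_Obj)

lemma zero_object_shift_pow: "zero_object D Z \<Longrightarrow> zero_object D ((ShO D ^^ n) Z)"
  by (induction n) (auto simp: zero_object_shift)

lemma tri_Obj: assumes "tri D X Y Z" shows "X \<in> Obj D" "Y \<in> Obj D" "Z \<in> Obj D"
  using assms Hom_Obj unfolding tri_def triangle_def by blast+

lemma tri_iso:
  assumes "tri D X Y Z" "iso_objects D X X'" "iso_objects D Y Y'" "iso_objects D Z Z'"
  shows "tri D X' Y' Z'"
proof -
  obtain f g h where t: "triangle D X Y Z f g h" using assms unfolding tri_def by blast
  then have fgh: "f \<in> Hom D X Y" "g \<in> Hom D Y Z" "h \<in> Hom D Z (ShO D X)"
    by (auto simp: triangle_def)
  obtain a a' where a: "iso_arrow D X X' a" "a \<in> Hom D X X'" "a' \<in> Hom D X' X" "a' \<cdot> a = Id D X"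
    using assms unfolding iso_objects_def iso_arrow_def by blast
  obtain b b' where b: "iso_arrow D Y Y' b" "b \<in> Hom D Y Y'" "b' \<in> Hom D Y' Y" "b' \<cdot> b = Id D Y"
    using assms unfolding iso_objects_def iso_arrow_def by blast
  obtain c c' where c: "iso_arrow D Z Z' c" "c \<in> Hom D Z Z'" "c' \<in> Hom D Z' Z" "c' \<cdot> c = Id D Z"
    using assms unfolding iso_objects_def iso_arrow_def by blast
  have bf: "b \<cdot> f \<in> Hom D X Y'" and cg: "c \<cdot> g \<in> Hom D Y Z'"
    and ah: "ShA D a \<cdot> h \<in> Hom D Z (ShO D X')"
    using fgh a b c Comp_in_Hom ShA_in_Hom by blast+
  have "triangle D X' Y' Z' (b \<cdot> f \<cdot> a') (c \<cdot> g \<cdot> b') (ShA D a \<cdot> h \<cdot> c')"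
  proof (rule Tri_iso[OF t _ _ _ a(1) b(1) c(1)])
    show "b \<cdot> f \<cdot> a' \<in> Hom D X' Y'" "c \<cdot> g \<cdot> b' \<in> Hom D Y' Z'"
      "ShA D a \<cdot> h \<cdot> c' \<in> Hom D Z' (ShO D X')"
      using bf cg ah a b c Comp_in_Hom by blast+
    show "b \<cdot> f = b \<cdot> f \<cdot> a' \<cdot> a" using Comp_assoc[OF a(2,3) bf] a Comp_Id[OF bf] by simp
    show "c \<cdot> g = c \<cdot> g \<cdot> b' \<cdot> b" using Comp_assoc[OF b(2,3) cg] b Comp_Id[OF cg] by simp
    show "ShA D a \<cdot> h = ShA D a \<cdot> h \<cdot> c' \<cdot> c"
      using Comp_assoc[OF c(2,3) ah] c Comp_Id[OF ah] by simp
  qed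
  then show ?thesis unfolding tri_def by blast
qed

lemma tri_rotate: "tri D X Y Z \<Longrightarrow> tri D Y Z (ShO D X)"
proof -
  assume "tri D X Y Z"
  then obtain f g h where t: "triangle D X Y Z f g h" unfolding tri_def by blast
  then have "f \<in> Hom D X Y" "g \<in> Hom D Y Z" "h \<in> Hom D Z (ShO D X)" by (auto simp: triangle_def)
  then show "tri D Y Z (ShO D X)" using Tri_rotate t unfolding tri_def by blast
qed

text \<open>
  The negative shift \<open>Z[-1]\<close> exists only up to isomorphism, so any \<open>W\<close> with \<open>W[1] \<cong> Z\<close> serves as one.
  Fullness of the shift turns the connecting arrow \<open>W[1] \<rightarrow> X[1]\<close> into an arrow \<open>W \<rightarrow> X\<close>, and the
  minus sign of the rotation axiom is absorbed in its choice.
\<close>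

lemma tri_rotate_back:
  assumes t: "tri D X Y Z" and W: "W \<in> Obj D" and iso: "iso_objects D (ShO D W) Z"
  shows "tri D W X Y"
proof -
  have "tri D X Y (ShO D W)"
    using tri_iso[OF t] iso_refl iso_sym[OF iso] tri_Obj[OF t] by blast
  then obtain f g h where fgh: "triangle D X Y (ShO D W) f g h" unfolding tri_def by blast
  then have h: "f \<in> Hom D X Y" "g \<in> Hom D Y (ShO D W)" "h \<in> Hom D (ShO D W) (ShO D X)"
    by (auto simp: triangle_def)
  then obtain k where k: "k \<in> Hom D W X" "ShA D k = Neg D h"
    using ShA_full[OF Neg_in_Hom[OF h(3)] W tri_Obj(1)[OF t]] by blast
  then have "triangle D W X Y k f g"
    using Tri_rotate[OF k(1) h(1,2)] fgh Neg_Neg[OF h(3)] by simp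
  then show ?thesis unfolding tri_def by blast
qed

lemma tri_shift: "tri D X Y Z \<Longrightarrow> tri D (ShO D X) (ShO D Y) (ShO D Z)"
  using tri_rotate by blast

lemma tri_shift_pow: "tri D X Y Z \<Longrightarrow> tri D ((ShO D ^^ n) X) ((ShO D ^^ n) Y) ((ShO D ^^ n) Z)"
  by (induction n) (auto simp: tri_shift)

lemma tri_unshift:
  assumes t: "tri D (ShO D X) (ShO D Y) (ShO D Z)" and "X \<in> Obj D" "Y \<in> Obj D" "Z \<in> Obj D"
  shows "tri D X Y Z"
proof -
  have "tri D Z (ShO D X) (ShO D Y)" using tri_rotate_back[OF t _ iso_refl] ShO_in_Obj assms by blast
  then have "tri D Y Z (ShO D X)" using tri_rotate_back[OF _ _ iso_refl] ShO_in_Obj assms by blast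
  then show ?thesis using tri_rotate_back[OF _ _ iso_refl] ShO_in_Obj assms by blast
qed

lemma tri_zero_right: "\<lbrakk>X \<in> Obj D; zero_object D Z\<rbrakk> \<Longrightarrow> tri D X X Z"
  unfolding tri_def using Tri_Id by blast

lemma triangle_zero_left: assumes "W \<in> Obj D" "zero_object D Z"
  shows "triangle D Z W W (Zero D Z W) (Id D W) (Zero D W (ShO D Z))"
proof -
  have Z: "Z \<in> Obj D" "ShO D Z \<in> Obj D" "ShO D W \<in> Obj D"
    using assms ShO_in_Obj by (auto simp: zero_object_def)
  have "Neg D (ShA D (Zero D Z W)) = Zero D (ShO D Z) (ShO D W)"
    using ShA_Zero Neg_Zero Z assms by simp
  then show ?thesis
    using Tri_rotate[of "Zero D Z W" Z W "Id D W" W "Zero D W (ShO D Z)"]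
      Tri_Id[OF assms(1) zero_object_shift[OF assms(2)]] Z assms Id_in_Hom by simp
qed

lemma tri_zero_left: "\<lbrakk>W \<in> Obj D; zero_object D Z\<rbrakk> \<Longrightarrow> tri D Z W W"
  unfolding tri_def using triangle_zero_left by blast

lemma tri_zero_mid: "\<lbrakk>W \<in> Obj D; zero_object D Z\<rbrakk> \<Longrightarrow> tri D W Z (ShO D W)"
  using tri_rotate tri_zero_right by blast

text \<open>
  An arrow \<open>u : Y \<rightarrow> W\<close> that kills \<open>f\<close> is the start of a morphism from the given triangle to
  \<open>0 \<rightarrow> W \<rightarrow> W \<rightarrow> 0[1]\<close>; its third component is the factorisation.
\<close>

lemma Hom_exact_contravariant:
  assumes t: "triangle D X Y Z f g h" and u: "u \<in> Hom D Y W" and uf: "u \<cdot> f = Zero D X W"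
  shows "\<exists>v \<in> Hom D Z W. u = v \<cdot> g"
proof -
  obtain N where N: "zero_object D N" using ex_zero_object by blast
  have obj: "N \<in> Obj D" "W \<in> Obj D" "X \<in> Obj D"
    using N u t Hom_Obj unfolding zero_object_def triangle_def by blast+
  have a: "Zero D X N \<in> Hom D X N" using obj by blast
  have "u \<cdot> f = Zero D N W \<cdot> Zero D X N" using uf Zero_Comp[OF a] obj by simp
  from Tri_morphism[OF t triangle_zero_left[OF obj(2) N] a u this]
  show ?thesis using Id_Comp[OF u] by metis
qed

text \<open>
  The morphism axiom completes two components to the third, so the missing arrow \<open>W \<rightarrow> X\<close> must be
  placed in the third position: the triangle \<open>W \<rightarrow> 0 \<rightarrow> W[1] \<rightarrow> W[1]\<close> is mapped to the rotated
  triangle, and the resulting arrow \<open>W[1] \<rightarrow> X[1]\<close> is shifted back.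
\<close>

lemma Hom_exact_covariant:
  assumes t: "triangle D X Y Z f g h" and u: "u \<in> Hom D W Y" and gu: "g \<cdot> u = Zero D W Z"
  shows "\<exists>v \<in> Hom D W X. u = f \<cdot> v"
proof -
  obtain N where N: "zero_object D N" using ex_zero_object by blast
  have fgh: "f \<in> Hom D X Y" "g \<in> Hom D Y Z" "h \<in> Hom D Z (ShO D X)"
    using t by (auto simp: triangle_def)
  have obj: "N \<in> Obj D" "W \<in> Obj D" "X \<in> Obj D" "Z \<in> Obj D"
    using N u fgh Hom_Obj unfolding zero_object_def by blast+
  have SW: "ShO D W \<in> Obj D" using obj ShO_in_Obj by blast
  have t1: "triangle D W N (ShO D W) (Zero D W N) (Zero D N (ShO D W))
      (Neg D (Id D (ShO D W)))"
    using Tri_rotate[of "Id D W" W W "Zero D W N" N "Zero D N (ShO D W)"] Tri_Id[OF obj(2) N]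
      Id_in_Hom obj SW ShA_Id by simp
  have t2: "triangle D Y Z (ShO D X) g h (Neg D (ShA D f))" using Tri_rotate fgh t by blast
  have b: "Zero D N Z \<in> Hom D N Z" "Zero D W N \<in> Hom D W N" using obj by blast+
  have "Zero D N Z \<cdot> Zero D W N = g \<cdot> u" using gu Zero_Comp[OF b(2)] obj by simp
  from Tri_morphism[OF t1 t2 u b(1) this]
  obtain c where c: "c \<in> Hom D (ShO D W) (ShO D X)"
    and *: "ShA D u \<cdot> Neg D (Id D (ShO D W)) = Neg D (ShA D f) \<cdot> c" by blast
  have su: "ShA D u \<in> Hom D (ShO D W) (ShO D Y)" and sf: "ShA D f \<in> Hom D (ShO D X) (ShO D Y)"
    using ShA_in_Hom u fgh by blast+
  have "Neg D (ShA D u) = Neg D (ShA D f \<cdot> c)"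
    using * unfolding Comp_Neg[OF Id_in_Hom[OF SW] su] Comp_Id[OF su] Neg_Comp[OF c sf] .
  then have eq: "ShA D u = ShA D f \<cdot> c"
    using Neg_Neg[OF su] Neg_Neg[OF Comp_in_Hom[OF c sf]] by metis
  obtain v where v: "v \<in> Hom D W X" "ShA D v = c" using ShA_full c obj by blast
  have "u = f \<cdot> v"
    using ShA_faithful[OF u Comp_in_Hom[OF v(1) fgh(1)]] ShA_Comp[OF v(1) fgh(1)] eq v by simp
  then show ?thesis using v by blast
qed

text \<open>
  Exactness gives \<open>g : X \<rightarrow> Y\<close> a left inverse because the arrow into \<open>X\<close> vanishes, and a right inverse
  because the arrow out of \<open>Y\<close> vanishes.
\<close>

lemma tri_first_zero_imp_iso:
  assumes t: "tri D T X Y" and T: "zero_object D T" shows "iso_objects D X Y"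
proof -
  obtain f g h where fgh: "triangle D T X Y f g h" using t unfolding tri_def by blast
  then have f: "f \<in> Hom D T X" and g: "g \<in> Hom D X Y" and h: "h \<in> Hom D Y (ShO D T)"
    by (auto simp: triangle_def)
  have obj: "X \<in> Obj D" "Y \<in> Obj D" "T \<in> Obj D" using tri_Obj[OF t] by auto
  have "Id D X \<cdot> f = Zero D T X"
    using f Id_Comp[OF f] T obj Zero_in_Hom unfolding zero_object_def by metis
  then obtain v where v: "v \<in> Hom D Y X" "Id D X = v \<cdot> g"
    using Hom_exact_contravariant[OF fgh Id_in_Hom] obj by blast
  have rot: "triangle D X Y (ShO D T) g h (Neg D (ShA D f))" using Tri_rotate f g h fgh by blast
  have "h \<cdot> Id D Y = Zero D Y (ShO D T)"
    using h Comp_Id[OF h] zero_object_shift[OF T] obj Zero_in_Hom unfolding zero_object_def by metis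
  then obtain w where w: "w \<in> Hom D Y X" "Id D Y = g \<cdot> w"
    using Hom_exact_covariant[OF rot Id_in_Hom] obj by blast
  have "v = w"
    using Comp_assoc[OF w(1) g v(1)] v(2) w(2) Comp_Id[OF v(1)] Id_Comp[OF w(1)] by simp
  then show ?thesis unfolding iso_objects_def iso_arrow_def using v w g by metis
qed

lemma unshift: assumes "Y \<in> Obj D" obtains X where "X \<in> Obj D" "iso_objects D (ShO D X) Y"
  using Sh_ess_surj[OF assms] by blast

lemma zero_object_unshift: assumes "zero_object D (ShO D Z)" "Z \<in> Obj D" shows "zero_object D Z"
  using assms unfolding zero_object_iff_Id
  by (metis Id_in_Hom ShA_Id ShA_Zero ShA_faithful Zero_in_Hom)

lemma zero_object_iso: assumes "zero_object D X" "iso_objects D X Y" shows "zero_object D Y"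
proof -
  have "Hom D X X = {Zero D X X}"
    using assms(1) Zero_in_Hom unfolding zero_object_def by blast
  then have "Hom D Y Y = {Zero D Y Y}" using Hom_zero_iso assms by blast
  then show ?thesis using Id_in_Hom iso_Obj[OF assms(2)] unfolding zero_object_iff_Id by blast
qed

lemma tri_last_zero_imp_iso:
  assumes t: "tri D X Y T" and T: "zero_object D T" shows "iso_objects D X Y"
proof -
  obtain W where W: "W \<in> Obj D" "iso_objects D (ShO D W) T" using unshift tri_Obj[OF t] by blast
  then have "zero_object D W" using zero_object_unshift zero_object_iso[OF T iso_sym] by blast
  then show ?thesis using tri_first_zero_imp_iso tri_rotate_back[OF t W] by blast
qed


section \<open>Extensions\<close>

text \<open>
  The octahedral axiom, read on objects: \<open>F\<close> is the cone of the composite \<open>A \<rightarrow> E \<rightarrow> Z\<close>.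
\<close>

lemma tri_assoc_right:
  assumes "tri D A E B" "tri D E Z C" shows "\<exists>F. tri D A Z F \<and> tri D B F C"
proof -
  obtain f f1 f2 where f: "triangle D A E B f f1 f2" using assms unfolding tri_def by blast
  obtain g g1 g2 where g: "triangle D E Z C g g1 g2" using assms unfolding tri_def by blast
  have "g \<cdot> f \<in> Hom D A Z" using f g Comp_in_Hom unfolding triangle_def by blast
  then obtain F k1 k2 where k: "triangle D A Z F (g \<cdot> f) k1 k2" using Tri_cone by blast
  have "\<exists>u v w. triangle D B F C u v w" using Tri_octahedral[OF f g k] by blast
  then show ?thesis using k unfolding tri_def by blast
qed

text \<open>
  The converse takes \<open>E\<close> to be the fibre of \<open>Z \<rightarrow> F \<rightarrow> C\<close>, that is, \<open>E[1]\<close> is the cone \<open>Q\<close> that the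
  octahedral axiom yields for the rotated triangles.
\<close>

lemma tri_assoc_left:
  assumes 1: "tri D A Z F" and 2: "tri D B F C" shows "\<exists>E. tri D A E B \<and> tri D E Z C"
proof -
  obtain Q where Q: "tri D Z C Q" "tri D (ShO D A) Q (ShO D B)"
    using tri_assoc_right tri_rotate 1 2 by blast
  obtain E where E: "E \<in> Obj D" "iso_objects D (ShO D E) Q" using unshift tri_Obj[OF Q(1)] by blast
  have "tri D (ShO D A) (ShO D E) (ShO D B)"
    using tri_iso[OF Q(2) iso_refl iso_sym[OF E(2)] iso_refl] tri_Obj[OF Q(2)] by blast
  then have "tri D A E B" using tri_unshift tri_Obj[OF 1] tri_Obj[OF 2] E by blast
  then show ?thesis using tri_rotate_back[OF Q(1) E] by blast
qed

lemma ext_prod_iff: "Z \<in> ext_prod D A B \<longleftrightarrow> (\<exists>X \<in> A. \<exists>Y \<in> B. tri D X Z Y)"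
  using tri_Obj(2) unfolding ext_prod_def tri_def[symmetric] by blast

lemma ext_prod_assoc: "ext_prod D (ext_prod D A B) C = ext_prod D A (ext_prod D B C)"
proof (intro equalityI subsetI)
  fix Z assume "Z \<in> ext_prod D (ext_prod D A B) C"
  then obtain X Y W E where "X \<in> A" "Y \<in> B" "W \<in> C" "tri D X E Y" "tri D E Z W"
    unfolding ext_prod_iff Bex_def by blast
  then show "Z \<in> ext_prod D A (ext_prod D B C)"
    unfolding ext_prod_iff Bex_def using tri_assoc_right by blast
next
  fix Z assume "Z \<in> ext_prod D A (ext_prod D B C)"
  then obtain X Y W F where "X \<in> A" "Y \<in> B" "W \<in> C" "tri D X Z F" "tri D Y F W"
    unfolding ext_prod_iff Bex_def by blast
  then show "Z \<in> ext_prod D (ext_prod D A B) C"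
    unfolding ext_prod_iff Bex_def using tri_assoc_left by blast
qed

lemma ext_prod_mono: "\<lbrakk>A \<subseteq> A'; B \<subseteq> B'\<rbrakk> \<Longrightarrow> ext_prod D A B \<subseteq> ext_prod D A' B'"
  unfolding ext_prod_def by blast

lemma ext_closedD: "\<lbrakk>ext_closed D A; tri D X Y Z; X \<in> A; Z \<in> A\<rbrakk> \<Longrightarrow> Y \<in> A"
  unfolding ext_closed_def using ext_prod_iff by blast

lemma ext_closedI: "(\<And>X Y Z. \<lbrakk>tri D X Y Z; X \<in> A; Z \<in> A\<rbrakk> \<Longrightarrow> Y \<in> A) \<Longrightarrow> ext_closed D A"
  unfolding ext_closed_def using ext_prod_iff by blast

text \<open>Associativity isolates the middle factor \<open>B * A\<close> of \<open>(A * B) * (A * B)\<close>.\<close>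

lemma ext_closed_ext_prod:
  assumes "ext_closed D A" "ext_closed D B" "ext_prod D B A \<subseteq> ext_prod D A B"
  shows "ext_closed D (ext_prod D A B)"
proof -
  have "ext_prod D (ext_prod D A B) (ext_prod D A B) = ext_prod D A (ext_prod D (ext_prod D B A) B)"
    by (simp add: ext_prod_assoc)
  also have "\<dots> \<subseteq> ext_prod D A (ext_prod D (ext_prod D A B) B)"
    by (rule ext_prod_mono[OF subset_refl ext_prod_mono[OF assms(3) subset_refl]])
  also have "\<dots> = ext_prod D (ext_prod D A A) (ext_prod D B B)" by (simp add: ext_prod_assoc)
  also have "\<dots> \<subseteq> ext_prod D A B" using assms by (intro ext_prod_mono) (auto simp: ext_closed_def)
  finally show ?thesis unfolding ext_closed_def .
qed

lemma subcat_ext_prod: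
  assumes "subcat D A" "subcat D B" shows "subcat D (ext_prod D A B)"
  unfolding subcat_def
proof (intro conjI ballI impI)
  show "ext_prod D A B \<subseteq> Obj D" by (auto simp: ext_prod_def)
  fix X Y assume "X \<in> ext_prod D A B" "iso_objects D X Y"
  then show "Y \<in> ext_prod D A B" unfolding ext_prod_iff using tri_iso iso_refl tri_Obj by metis
next
  obtain N where N: "zero_object D N" using ex_zero_object by blast
  then have "tri D N N N" using tri_zero_left[OF zero_object_Obj] by simp
  then show "\<exists>Z\<in>ext_prod D A B. zero_object D Z"
    using N subcat_zero[OF assms(1) N] subcat_zero[OF assms(2) N] ext_prod_iff by metis
qed

lemma subset_ext_prod_left: assumes "subcat D A" "subcat D B" shows "A \<subseteq> ext_prod D A B"
proof
  fix X assume X: "X \<in> A"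
  obtain N where "N \<in> B" "zero_object D N" using assms unfolding subcat_def by blast
  then show "X \<in> ext_prod D A B"
    using X tri_zero_right[of X N] assms(1) unfolding ext_prod_iff subcat_def by blast
qed

lemma subset_ext_prod_right: assumes "subcat D A" "subcat D B" shows "B \<subseteq> ext_prod D A B"
proof
  fix X assume X: "X \<in> B"
  obtain N where "N \<in> A" "zero_object D N" using assms unfolding subcat_def by blast
  then show "X \<in> ext_prod D A B"
    using X tri_zero_left[of X N] assms(2) unfolding ext_prod_iff subcat_def by blast
qed


section \<open>Truncation levels\<close>

lemma trunc_Obj: "trunc D A n \<subseteq> Obj D"
  unfolding trunc_def shift_sub_def by auto

lemma trunc_iso: assumes "Y \<in> trunc D A n" "iso_objects D Y Y'" shows "Y' \<in> trunc D A n"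
  using assms iso_trans[OF iso_shift_pow[OF iso_sym[OF assms(2)]]] iso_Obj[OF assms(2)]
  unfolding trunc_def shift_sub_def by blast

lemma trunc_0: assumes "subcat D A" shows "trunc D A 0 = A"
proof -
  have "A = {Y \<in> Obj D. \<exists>X \<in> A. iso_objects D Y X}"
  proof (intro equalityI subsetI)
    fix Y assume "Y \<in> A"
    moreover from this have "Y \<in> Obj D" using assms unfolding subcat_def by blast
    ultimately show "Y \<in> {Y \<in> Obj D. \<exists>X \<in> A. iso_objects D Y X}" using iso_refl by blast
  next
    fix Y assume "Y \<in> {Y \<in> Obj D. \<exists>X \<in> A. iso_objects D Y X}"
    then show "Y \<in> A" using subcat_iso[OF assms _ iso_sym] by blast
  qed
  also have "\<dots> = trunc D A 0" by (simp add: trunc_def shift_sub_def)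
  finally show ?thesis by (rule sym)
qed

text \<open>
  For \<open>n \<ge> 0\<close> both sides shift \<open>Y\<close> by \<open>n + 1\<close> and only bracket the shifts differently; for \<open>n < 0\<close>
  the claim is that the shift preserves and reflects isomorphisms. This rule makes induction on the
  level possible without looking at the sign of the level again.
\<close>

lemma trunc_shift_iff: assumes "A \<subseteq> Obj D" "Y \<in> Obj D"
  shows "ShO D Y \<in> trunc D A n \<longleftrightarrow> Y \<in> trunc D A (n + 1)"
proof (cases "n \<ge> 0")
  case True
  then have e: "nat (- (- (n + 1))) = Suc (nat n)" "nat (- (- n)) = nat n"
      "nat (- n) = 0" "nat (- (n + 1)) = 0" by auto
  show ?thesis unfolding trunc_def shift_sub_def e
    using assms ShO_in_Obj by (simp add: funpow_swap1)
next
  case False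
  then have e: "nat (- n) = Suc (nat (- (n + 1)))" "nat (- (- n)) = 0" "nat (- (- (n + 1))) = 0"
    by auto
  show ?thesis unfolding trunc_def shift_sub_def e
    using assms ShO_in_Obj iso_shift_iff shift_pow_Obj by (auto simp: subset_iff)
qed

lemma trunc_shift: "\<lbrakk>A \<subseteq> Obj D; Y \<in> trunc D A (n + 1)\<rbrakk> \<Longrightarrow> ShO D Y \<in> trunc D A n"
  using trunc_shift_iff[of A Y n] trunc_Obj[of A "n + 1"] by blast

lemma trunc_unshift_mem:
  assumes "A \<subseteq> Obj D" "X \<in> Obj D" "iso_objects D (ShO D X) Y" "Y \<in> trunc D A n"
  shows "X \<in> trunc D A (n + 1)"
  using trunc_shift_iff[OF assms(1,2), of n] trunc_iso[OF assms(4) iso_sym[OF assms(3)]] by blast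

lemma trunc_unshift: assumes "A \<subseteq> Obj D" "Y \<in> trunc D A n"
  obtains X where "X \<in> trunc D A (n + 1)" "iso_objects D (ShO D X) Y"
proof -
  have "Y \<in> Obj D" using assms(2) trunc_Obj by blast
  then obtain X where X: "X \<in> Obj D" "iso_objects D (ShO D X) Y" using unshift by blast
  show ?thesis by (rule that[OF trunc_unshift_mem[OF assms(1) X assms(2)] X(2)])
qed

lemma trunc_subset_shift_iff:
  assumes A: "A \<subseteq> Obj D" and B: "B \<subseteq> Obj D"
  shows "trunc D A m \<subseteq> trunc D B n \<longleftrightarrow> trunc D A (m + 1) \<subseteq> trunc D B (n + 1)"
proof
  assume sub: "trunc D A m \<subseteq> trunc D B n"
  show "trunc D A (m + 1) \<subseteq> trunc D B (n + 1)"
  proof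
    fix Y assume Y: "Y \<in> trunc D A (m + 1)"
    then have "Y \<in> Obj D" using trunc_Obj by blast
    moreover have "ShO D Y \<in> trunc D B n" using trunc_shift[OF A Y] sub by blast
    ultimately show "Y \<in> trunc D B (n + 1)" using trunc_shift_iff[OF B] by blast
  qed
next
  assume sub: "trunc D A (m + 1) \<subseteq> trunc D B (n + 1)"
  show "trunc D A m \<subseteq> trunc D B n"
  proof
    fix Y assume "Y \<in> trunc D A m"
    then obtain X where X: "X \<in> trunc D A (m + 1)" "iso_objects D (ShO D X) Y"
      by (rule trunc_unshift[OF A])
    then have "ShO D X \<in> trunc D B n" using trunc_shift[OF B] sub by blast
    then show "Y \<in> trunc D B n" using trunc_iso X(2) by blast
  qed
qed

lemma trunc_subset_translate:
  assumes "A \<subseteq> Obj D" "B \<subseteq> Obj D" "trunc D A m \<subseteq> trunc D B n"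
  shows "trunc D A (m + k) \<subseteq> trunc D B (n + k)"
proof (induction k rule: int_induct[where k = 0])
  case base
  then show ?case using assms(3) by simp
next
  case (step1 k)
  then show ?case
    using trunc_subset_shift_iff[OF assms(1,2), of "m + k" "n + k"] by (simp add: add.assoc)
next
  case (step2 k)
  then show ?case
    using trunc_subset_shift_iff[OF assms(1,2), of "m + (k - 1)" "n + (k - 1)"]
    by (simp add: algebra_simps)
qed

lemma subcat_trunc: assumes "subcat D A" shows "subcat D (trunc D A n)"
proof -
  obtain N where N: "N \<in> A" "zero_object D N" using assms unfolding subcat_def by blast
  then have "N \<in> trunc D A n" unfolding trunc_def shift_sub_def mem_Collect_eq
    using zero_objects_iso zero_object_shift_pow zero_object_Obj by blast
  then show ?thesis unfolding subcat_def using N trunc_Obj trunc_iso by blast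
qed

end

locale t_structured_cat = triangulated_cat D for D :: "('o, 'a) tricat" (structure) +
  fixes U V :: "'o set"
  assumes t_str: "t_structure D U V"
begin

abbreviation "aisle n \<equiv> trunc D U n"
abbreviation "coaisle n \<equiv> trunc D V n"

lemma subcat_UV: "subcat D U" "subcat D V"
  using t_str unfolding t_structure_def by auto

lemma UV_Obj: "U \<subseteq> Obj D" "V \<subseteq> Obj D"
  using subcat_UV unfolding subcat_def by auto

lemmas aisle_0 = trunc_0[OF subcat_UV(1)] and coaisle_0 = trunc_0[OF subcat_UV(2)]
lemmas aisle_shift = trunc_shift[OF UV_Obj(1)] and coaisle_shift = trunc_shift[OF UV_Obj(2)]
lemmas aisle_unshift = trunc_unshift[OF UV_Obj(1)] and coaisle_unshift = trunc_unshift[OF UV_Obj(2)]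
lemmas coaisle_unshift_mem = trunc_unshift_mem[OF UV_Obj(2)]

lemma aisle_step: "aisle n \<subseteq> aisle (n + 1)"
  using trunc_subset_translate[OF UV_Obj(1) UV_Obj(1), of "-1" 0 "n + 1"] t_str aisle_0
  unfolding t_structure_def by (simp add: add.commute)

lemma coaisle_step: "coaisle (n + 1) \<subseteq> coaisle n"
  using trunc_subset_translate[OF UV_Obj(2) UV_Obj(2), of 1 0 n] t_str coaisle_0
  unfolding t_structure_def by (simp add: add.commute)

lemma shift_mem_aisle: "X \<in> aisle n \<Longrightarrow> ShO D X \<in> aisle n"
  using aisle_shift aisle_step by blast

lemma aisle_mono: "m \<le> n \<Longrightarrow> aisle m \<subseteq> aisle n"
proof (induction n rule: int_ge_induct)
  case (step n)
  then show ?case using aisle_step[of n] by blast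
qed simp

lemma coaisle_mono: "m \<le> n \<Longrightarrow> coaisle n \<subseteq> coaisle m"
proof (induction n rule: int_ge_induct)
  case (step n)
  then show ?case using coaisle_step[of n] by blast
qed simp

text \<open>
  The axioms of a t-structure speak about levels next to 0. The shift is fully faithful and essentially
  surjective, so they propagate to all levels, upwards and downwards.
\<close>

lemma Hom_aisle_coaisle_step: "\<forall>A \<in> aisle n. \<forall>B \<in> coaisle (n + 1). Hom D A B = {Zero D A B}"
proof (induction n rule: int_induct[where k = 0])
  case base
  then show ?case using t_str aisle_0 unfolding t_structure_def by simp
next
  case (step1 n)
  show ?case
  proof (intro ballI)
    fix A B assume AB: "A \<in> aisle (n + 1)" "B \<in> coaisle (n + 1 + 1)"
    then have "A \<in> Obj D" "B \<in> Obj D" using trunc_Obj by blast+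
    moreover have "Hom D (ShO D A) (ShO D B) = {Zero D (ShO D A) (ShO D B)}"
      using step1 aisle_shift[OF AB(1)] coaisle_shift[OF AB(2)] by blast
    ultimately show "Hom D A B = {Zero D A B}" using Hom_zero_shift_iff by blast
  qed
next
  case (step2 n)
  show ?case
  proof (intro ballI)
    fix A B assume "A \<in> aisle (n - 1)" "B \<in> coaisle (n - 1 + 1)"
    then have AB: "A \<in> aisle (n - 1)" "B \<in> coaisle n" by simp_all
    obtain A' where A: "A' \<in> aisle (n - 1 + 1)" "iso_objects D (ShO D A') A"
      using aisle_unshift[OF AB(1)] .
    obtain B' where B: "B' \<in> coaisle (n + 1)" "iso_objects D (ShO D B') B"
      using coaisle_unshift[OF AB(2)] .
    have "A' \<in> Obj D" "B' \<in> Obj D" using A B trunc_Obj by blast+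
    moreover have "Hom D A' B' = {Zero D A' B'}" using step2 A B by simp
    ultimately show "Hom D A B = {Zero D A B}"
      using Hom_zero_shift_iff Hom_zero_iso[OF A(2) B(2)] by blast
  qed
qed

lemma Hom_aisle_coaisle: "\<lbrakk>A \<in> aisle m; B \<in> coaisle n; m < n\<rbrakk> \<Longrightarrow> Hom D A B = {Zero D A B}"
  using Hom_aisle_coaisle_step[of m] coaisle_mono[of "m + 1" n] by auto

lemma truncation_triangle_all: "\<forall>Z \<in> Obj D. \<exists>T \<in> aisle n. \<exists>W \<in> coaisle (n + 1). tri D T Z W"
proof (induction n rule: int_induct[where k = 0])
  case base
  have "Z \<in> ext_prod D U (coaisle 1)" if "Z \<in> Obj D" for Z
    using that t_str unfolding t_structure_def by simp
  then show ?case using aisle_0 ext_prod_iff by simp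
next
  case (step1 n)
  show ?case
  proof
    fix Z assume Z: "Z \<in> Obj D"
    then obtain T' W' where tw: "T' \<in> aisle n" "W' \<in> coaisle (n + 1)" "tri D T' (ShO D Z) W'"
      using step1 ShO_in_Obj by blast
    obtain T where T: "T \<in> aisle (n + 1)" "iso_objects D (ShO D T) T'" using aisle_unshift[OF tw(1)] .
    obtain W where W: "W \<in> coaisle (n + 1 + 1)" "iso_objects D (ShO D W) W'"
      using coaisle_unshift[OF tw(2)] .
    have "tri D (ShO D T) (ShO D Z) (ShO D W)"
      using tri_iso[OF tw(3) iso_sym[OF T(2)] iso_refl iso_sym[OF W(2)]] Z ShO_in_Obj by blast
    then have "tri D T Z W" using tri_unshift T W Z trunc_Obj by blast
    then show "\<exists>T \<in> aisle (n + 1). \<exists>W \<in> coaisle (n + 1 + 1). tri D T Z W" using T W by blast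
  qed
next
  case (step2 n)
  show ?case
  proof
    fix Z assume "Z \<in> Obj D"
    then obtain Z' where Z: "Z' \<in> Obj D" "iso_objects D (ShO D Z') Z" using unshift by blast
    then obtain T W where tw: "T \<in> aisle n" "W \<in> coaisle (n + 1)" "tri D T Z' W" using step2 by blast
    have "ShO D T \<in> aisle (n - 1)" "ShO D W \<in> coaisle (n - 1 + 1)"
      using aisle_shift[of T "n - 1"] coaisle_shift[of W n] tw by simp_all
    moreover have "tri D (ShO D T) Z (ShO D W)"
      using tri_iso[OF tri_shift[OF tw(3)] iso_refl Z(2) iso_refl] tri_Obj[OF tw(3)] ShO_in_Obj
      by blast
    ultimately show "\<exists>T \<in> aisle (n - 1). \<exists>W \<in> coaisle (n - 1 + 1). tri D T Z W" by blast
  qed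
qed

lemma truncation_triangle:
  assumes "Z \<in> Obj D" obtains T W where "T \<in> aisle n" "W \<in> coaisle (n + 1)" "tri D T Z W"
  using truncation_triangle_all assms by blast

lemma zero_object_if_aisle_coaisle: "\<lbrakk>X \<in> aisle m; X \<in> coaisle n; m < n\<rbrakk> \<Longrightarrow> zero_object D X"
  using Hom_aisle_coaisle[of X m X n] trunc_Obj Id_in_Hom[of X] unfolding zero_object_iff_Id by blast

text \<open>
  Truncate \<open>X\<close> into \<open>T \<rightarrow> X \<rightarrow> W\<close>. As \<open>X \<rightarrow> W\<close> vanishes, the identity of \<open>W\<close> factors through
  \<open>T[1]\<close>. There are no arrows from \<open>T[1]\<close> to \<open>W\<close>, so \<open>W\<close> is zero and \<open>X \<cong> T\<close>.
\<close>

lemma aisle_if_Hom_coaisle_zero: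
  assumes X: "X \<in> Obj D" and zero: "\<And>W. W \<in> coaisle (n + 1) \<Longrightarrow> Hom D X W = {Zero D X W}"
  shows "X \<in> aisle n"
proof -
  obtain T W where tw: "T \<in> aisle n" "W \<in> coaisle (n + 1)" "tri D T X W"
    using truncation_triangle[OF X] .
  then obtain f g h where fgh: "triangle D T X W f g h" unfolding tri_def by blast
  then have *: "f \<in> Hom D T X" "g \<in> Hom D X W" "h \<in> Hom D W (ShO D T)" by (auto simp: triangle_def)
  have W: "W \<in> Obj D" "T \<in> Obj D" using tri_Obj[OF tw(3)] by auto
  have rot: "triangle D X W (ShO D T) g h (Neg D (ShA D f))" using Tri_rotate * fgh by blast
  have "Id D W \<cdot> g = Zero D X W" using zero[OF tw(2)] Id_Comp[OF *(2)] *(2) by simp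
  then obtain r where r: "r \<in> Hom D (ShO D T) W" "Id D W = r \<cdot> h"
    using Hom_exact_contravariant[OF rot Id_in_Hom] W by blast
  have "ShO D T \<in> aisle (n - 1)" using aisle_shift[of T "n - 1"] tw by simp
  then have "r = Zero D (ShO D T) W" using r Hom_aisle_coaisle tw by fastforce
  then have "zero_object D W"
    using r(2) Zero_Comp[OF *(3)] W unfolding zero_object_iff_Id by simp
  then show ?thesis using tri_last_zero_imp_iso tw trunc_iso by blast
qed

text \<open>Dually, the identity of the lower part \<open>T\<close> of \<open>Y\<close> factors through \<open>W[-1]\<close>.\<close>

lemma coaisle_if_Hom_aisle_zero:
  assumes Y: "Y \<in> Obj D" and zero: "\<And>T. T \<in> aisle n \<Longrightarrow> Hom D T Y = {Zero D T Y}"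
  shows "Y \<in> coaisle (n + 1)"
proof -
  obtain T W where tw: "T \<in> aisle n" "W \<in> coaisle (n + 1)" "tri D T Y W"
    using truncation_triangle[OF Y] .
  obtain W' where W': "W' \<in> coaisle (n + 1 + 1)" "iso_objects D (ShO D W') W"
    using coaisle_unshift[OF tw(2)] .
  have "tri D W' T Y" using tri_rotate_back tw W' trunc_Obj by blast
  then obtain f g h where fgh: "triangle D W' T Y f g h" unfolding tri_def by blast
  then have *: "f \<in> Hom D W' T" "g \<in> Hom D T Y" by (auto simp: triangle_def)
  have T: "T \<in> Obj D" using tri_Obj[OF tw(3)] by auto
  have "g \<cdot> Id D T = Zero D T Y" using zero[OF tw(1)] Comp_Id[OF *(2)] *(2) by simp
  then obtain r where r: "r \<in> Hom D T W'" "Id D T = f \<cdot> r"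
    using Hom_exact_covariant[OF fgh Id_in_Hom] T by blast
  then have "r = Zero D T W'" using Hom_aisle_coaisle[OF tw(1) W'(1)] by simp
  then have "zero_object D T"
    using r(2) Comp_Zero[OF *(1)] T unfolding zero_object_iff_Id by simp
  then show ?thesis using tri_first_zero_imp_iso tw trunc_iso iso_sym by blast
qed

text \<open>
  Vanishing of \<open>Hom\<close> into, or out of, a fixed object passes to extensions by exactness, and aisles and
  coaisles are characterised by such vanishing.
\<close>

lemma ext_closed_aisle: "ext_closed D (aisle n)"
proof (rule ext_closedI)
  fix X Y Z assume t: "tri D X Y Z" and X: "X \<in> aisle n" and Z: "Z \<in> aisle n"
  obtain f g h where fgh: "triangle D X Y Z f g h" using t unfolding tri_def by blast
  then have *: "f \<in> Hom D X Y" "g \<in> Hom D Y Z" by (auto simp: triangle_def)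
  show "Y \<in> aisle n"
  proof (rule aisle_if_Hom_coaisle_zero)
    show Y: "Y \<in> Obj D" using tri_Obj[OF t] by blast
    fix W assume W: "W \<in> coaisle (n + 1)"
    then have W_Obj: "W \<in> Obj D" using trunc_Obj by blast
    have "u = Zero D Y W" if u: "u \<in> Hom D Y W" for u
    proof -
      have "u \<cdot> f = Zero D X W" using Hom_aisle_coaisle[OF X W] Comp_in_Hom[OF *(1) u] by simp
      then obtain v where v: "v \<in> Hom D Z W" "u = v \<cdot> g"
        using Hom_exact_contravariant[OF fgh u] by blast
      then show ?thesis using Hom_aisle_coaisle[OF Z W] Zero_Comp[OF *(2) W_Obj] by simp
    qed
    then show "Hom D Y W = {Zero D Y W}" using Y W_Obj by blast
  qed
qed

lemma ext_closed_coaisle: "ext_closed D (coaisle n)"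
proof (rule ext_closedI)
  fix X Y Z assume t: "tri D X Y Z" and X: "X \<in> coaisle n" and Z: "Z \<in> coaisle n"
  obtain f g h where fgh: "triangle D X Y Z f g h" using t unfolding tri_def by blast
  then have *: "f \<in> Hom D X Y" "g \<in> Hom D Y Z" by (auto simp: triangle_def)
  have "Y \<in> coaisle (n - 1 + 1)"
  proof (rule coaisle_if_Hom_aisle_zero)
    show Y: "Y \<in> Obj D" using tri_Obj[OF t] by blast
    fix T assume T: "T \<in> aisle (n - 1)"
    then have T_Obj: "T \<in> Obj D" using trunc_Obj by blast
    have "u = Zero D T Y" if u: "u \<in> Hom D T Y" for u
    proof -
      have "g \<cdot> u = Zero D T Z" using Hom_aisle_coaisle[OF T Z] Comp_in_Hom[OF u *(2)] by simp
      then obtain v where v: "v \<in> Hom D T X" "u = f \<cdot> v"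
        using Hom_exact_covariant[OF fgh u] by blast
      then show ?thesis using Hom_aisle_coaisle[OF T X] Comp_Zero[OF *(1) T_Obj] by simp
    qed
    then show "Hom D T Y = {Zero D T Y}" using Y T_Obj by blast
  qed
  then show "Y \<in> coaisle n" by simp
qed

lemmas aisle_ext = ext_closedD[OF ext_closed_aisle]
  and coaisle_ext = ext_closedD[OF ext_closed_coaisle]

lemma t_interval_0: "t_interval D U V m 0 = U \<inter> coaisle m"
  unfolding t_interval_def by (simp add: aisle_0)

end


section \<open>Iterated factors\<close>

text \<open>
  Peeling off one triangle at a time makes the chain of a d-factor accessible to induction. The
  interval \<open>I\<close> is a parameter because in \<^const>\<open>d_factor\<close> it is tied to the length of the chain.
\<close>

primrec iterated_factor ::
  "('o, 'a) tricat \<Rightarrow> 'o set \<Rightarrow> 'o set \<Rightarrow> nat \<Rightarrow> 'o \<Rightarrow> bool" where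
  "iterated_factor D I \<X> 0 Z \<longleftrightarrow> Z \<in> I"
| "iterated_factor D I \<X> (Suc k) Z \<longleftrightarrow>
     Z \<in> I \<and> (\<exists>X \<in> \<X>. \<exists>Z'. tri D Z' X Z \<and> iterated_factor D I \<X> k Z')"

lemma iterated_factor_iff_chain:
  "iterated_factor D I \<X> k Z \<longleftrightarrow> Z \<in> I \<and>
     (\<exists>Zs Xs. Zs 0 = Z \<and>
       (\<forall>i \<in> {1..k}. Zs i \<in> I \<and> Xs i \<in> \<X> \<and> tri D (Zs i) (Xs i) (Zs (i - 1))))"
proof (induction k arbitrary: Z)
  case 0
  show ?case by auto
next
  case (Suc k)
  show ?case
  proof
    assume "iterated_factor D I \<X> (Suc k) Z"
    then obtain X Z' where *: "Z \<in> I" "X \<in> \<X>" "tri D Z' X Z" "iterated_factor D I \<X> k Z'" by auto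
    then obtain Zs Xs where c: "Z' \<in> I" "Zs 0 = Z'"
      "\<And>i. i \<in> {1..k} \<Longrightarrow> Zs i \<in> I \<and> Xs i \<in> \<X> \<and> tri D (Zs i) (Xs i) (Zs (i - 1))"
      using Suc.IH by blast
    define Zs' Xs' where "Zs' = (\<lambda>i. if i = 0 then Z else Zs (i - 1))"
      and "Xs' = (\<lambda>i. if i = 1 then X else Xs (i - 1))"
    have "Zs' i \<in> I \<and> Xs' i \<in> \<X> \<and> tri D (Zs' i) (Xs' i) (Zs' (i - 1))" if "i \<in> {1..Suc k}" for i
    proof (cases "i = 1")
      case True
      then show ?thesis using * c(1,2) by (simp add: Zs'_def Xs'_def)
    next
      case False
      then have "i - 1 \<in> {1..k}" "i \<noteq> 0" "i - 1 \<noteq> 0" using that by auto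
      then show ?thesis using c(3)[of "i - 1"] False by (simp add: Zs'_def Xs'_def)
    qed
    moreover have "Zs' 0 = Z" by (simp add: Zs'_def)
    ultimately show "Z \<in> I \<and> (\<exists>Zs Xs. Zs 0 = Z \<and>
       (\<forall>i \<in> {1..Suc k}. Zs i \<in> I \<and> Xs i \<in> \<X> \<and> tri D (Zs i) (Xs i) (Zs (i - 1))))"
      using *(1) by blast
  next
    assume "Z \<in> I \<and> (\<exists>Zs Xs. Zs 0 = Z \<and>
       (\<forall>i \<in> {1..Suc k}. Zs i \<in> I \<and> Xs i \<in> \<X> \<and> tri D (Zs i) (Xs i) (Zs (i - 1))))"
    then obtain Zs Xs where c: "Z \<in> I" "Zs 0 = Z"
      "\<And>i. i \<in> {1..Suc k} \<Longrightarrow> Zs i \<in> I \<and> Xs i \<in> \<X> \<and> tri D (Zs i) (Xs i) (Zs (i - 1))" by blast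
    define Zs' Xs' where "Zs' = (\<lambda>i. Zs (Suc i))" and "Xs' = (\<lambda>i. Xs (Suc i))"
    have "Zs' i \<in> I \<and> Xs' i \<in> \<X> \<and> tri D (Zs' i) (Xs' i) (Zs' (i - 1))" if "i \<in> {1..k}" for i
      using that c(3)[of "Suc i"] by (auto simp: Zs'_def Xs'_def)
    moreover have "Zs' 0 = Zs 1" by (simp add: Zs'_def)
    moreover have "Zs 1 \<in> I" using c(3)[of 1] by simp
    ultimately have "iterated_factor D I \<X> k (Zs 1)" unfolding Suc.IH by blast
    moreover have "tri D (Zs 1) (Xs 1) Z" "Xs 1 \<in> \<X>" using c(2) c(3)[of 1] by auto
    ultimately show "iterated_factor D I \<X> (Suc k) Z" using c(1) by auto
  qed
qed

lemma d_factor_iff_iterated_factor: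
  "d_factor D U V d \<X> Z \<longleftrightarrow> iterated_factor D (t_interval D U V (- int d + 1) 0) \<X> d Z"
  unfolding d_factor_def iterated_factor_iff_chain tri_def ..


section \<open>Suspended subcategories\<close>

context t_structured_cat
begin

lemma suspended_shift: assumes "suspended D \<C>" "X \<in> \<C>" shows "ShO D X \<in> \<C>"
proof -
  have "X \<in> Obj D" using assms unfolding suspended_def subcat_def by blast
  then have "ShO D X \<in> shift_sub D \<C> 1"
    using assms(2) ShO_in_Obj iso_refl unfolding shift_sub_def by auto
  then show ?thesis using assms(1) zero_less_one unfolding suspended_def by blast
qed

lemma suspended_shift_pow: "\<lbrakk>suspended D \<C>; X \<in> \<C>\<rbrakk> \<Longrightarrow> (ShO D ^^ n) X \<in> \<C>"
  by (induction n) (auto simp: suspended_shift)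

lemma suspendedI:
  assumes C: "subcat D \<C>" "ext_closed D \<C>" and shift: "\<And>X. X \<in> \<C> \<Longrightarrow> ShO D X \<in> \<C>"
  shows "suspended D \<C>"
proof -
  have pow: "(ShO D ^^ n) X \<in> \<C>" if "X \<in> \<C>" for X n
    using that by (induction n) (auto simp: shift)
  have "shift_sub D \<C> n \<subseteq> \<C>" if "n > 0" for n
    using that pow subcat_iso[OF C(1) _ iso_sym] unfolding shift_sub_def by force
  then show ?thesis unfolding suspended_def using C by blast
qed

text \<open>
  The invariant is that the object reached after \<open>j\<close> of the \<open>d\<close> steps lies in \<open>\<C>\<close> once shifted by \<open>j\<close>.
  At the end of the chain this is \<open>D\<^sup>\<le>\<^sup>0[d] = D\<^sup>\<le>\<^sup>-\<^sup>d \<subseteq> \<C>\<close>, and a triangle \<open>Z' \<rightarrow> X \<rightarrow> Z\<close> gives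
  \<open>Z[j]\<close> as an extension of \<open>Z'[j + 1]\<close> by \<open>X[j]\<close>.
\<close>

lemma iterated_factor_shift_mem:
  assumes C: "suspended D \<C>" "aisle (- int d) \<subseteq> \<C>" and \<X>: "\<X> \<subseteq> \<C>"
  shows "\<lbrakk>iterated_factor D (t_interval D U V m 0) \<X> k Z; j + k = d\<rbrakk> \<Longrightarrow> (ShO D ^^ j) Z \<in> \<C>"
proof (induction k arbitrary: j Z)
  case 0
  have Z: "Z \<in> aisle 0" using "0.prems" by (simp add: t_interval_def)
  have "(ShO D ^^ n) Z \<in> aisle (- int n)" for n
  proof (induction n)
    case 0
    then show ?case using Z by simp
  next
    case (Suc n)
    then show ?case using aisle_shift[of "(ShO D ^^ n) Z" "- int (Suc n)"] by simp
  qed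
  then show ?case using 0 C by auto
next
  case (Suc k)
  then obtain X Z' where *: "X \<in> \<X>" "tri D Z' X Z" "iterated_factor D (t_interval D U V m 0) \<X> k Z'"
    by auto
  have "tri D ((ShO D ^^ j) X) ((ShO D ^^ j) Z) ((ShO D ^^ j) (ShO D Z'))"
    using tri_shift_pow tri_rotate *(2) by blast
  moreover have "(ShO D ^^ j) X \<in> \<C>" using suspended_shift_pow C(1) \<X> * by blast
  moreover have "(ShO D ^^ j) (ShO D Z') \<in> \<C>"
    using Suc.IH[OF *(3), of "Suc j"] Suc.prems by (simp add: funpow_swap1)
  ultimately show ?case using ext_closedD C(1) unfolding suspended_def by blast
qed

lemma d_FAE_closed_Int:
  assumes C: "suspended D \<C>" "aisle (- int d) \<subseteq> \<C>"
  shows "d_FAE_closed D U V d (\<C> \<inter> t_interval D U V (- int d + 1) 0)"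
  unfolding d_FAE_closed_def
proof (intro conjI allI impI)
  let ?I = "t_interval D U V (- int d + 1) 0"
  have sub: "subcat D \<C>" and ext: "ext_closed D \<C>" using C unfolding suspended_def by auto
  show "subcat D (\<C> \<inter> ?I)"
    unfolding subcat_def t_interval_def
  proof (intro conjI ballI impI)
    show "\<C> \<inter> (aisle 0 \<inter> coaisle (- int d + 1)) \<subseteq> Obj D" using trunc_Obj by blast
    show "\<exists>Z\<in>\<C> \<inter> (aisle 0 \<inter> coaisle (- int d + 1)). zero_object D Z"
      using subcat_zero sub subcat_trunc subcat_UV ex_zero_object by blast
  qed (use subcat_iso[OF sub] trunc_iso in blast)
  show "\<C> \<inter> ?I \<subseteq> ?I" by blast
  show "ext_closed D (\<C> \<inter> ?I)"
    unfolding t_interval_def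
    using ext_closedD[OF ext] aisle_ext coaisle_ext by (intro ext_closedI) blast
  fix Z assume "d_factor D U V d (\<C> \<inter> ?I) Z"
  then have f: "iterated_factor D ?I (\<C> \<inter> ?I) d Z" by (rule d_factor_iff_iterated_factor[THEN iffD1])
  have "Z \<in> \<C>" using iterated_factor_shift_mem[OF C _ f, of 0] by simp
  moreover have "Z \<in> ?I" using f iterated_factor_iff_chain by metis
  ultimately show "Z \<in> \<C> \<inter> ?I" by blast
qed

lemma ext_prod_Int_eq:
  assumes C: "suspended D \<C>" "aisle (- int d) \<subseteq> \<C>" "\<C> \<subseteq> U"
  shows "ext_prod D (aisle (- int d)) (\<C> \<inter> t_interval D U V (- int d + 1) 0) = \<C>"
proof
  have ext: "ext_closed D \<C>" using C unfolding suspended_def by auto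
  show "ext_prod D (aisle (- int d)) (\<C> \<inter> t_interval D U V (- int d + 1) 0) \<subseteq> \<C>"
    using ext C(2) ext_prod_mono[of "aisle (- int d)" \<C>] unfolding ext_closed_def by blast
  show "\<C> \<subseteq> ext_prod D (aisle (- int d)) (\<C> \<inter> t_interval D U V (- int d + 1) 0)"
  proof
    fix Z assume Z: "Z \<in> \<C>"
    then have "Z \<in> Obj D" using C(3) UV_Obj by blast
    then obtain T W where tw: "T \<in> aisle (- int d)" "W \<in> coaisle (- int d + 1)" "tri D T Z W"
      using truncation_triangle by blast
    have "ShO D T \<in> \<C>" using suspended_shift C tw by blast
    then have "W \<in> \<C>" using ext_closedD[OF ext tri_rotate[OF tw(3)]] Z by blast
    then show "Z \<in> ext_prod D (aisle (- int d)) (\<C> \<inter> t_interval D U V (- int d + 1) 0)"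
      unfolding ext_prod_iff t_interval_0 using tw C(3) by blast
  qed
qed


section \<open>Subcategories closed under d-factors\<close>

text \<open>
  The triangles \<open>Z[-1] \<rightarrow> 0 \<rightarrow> Z\<close> extend a chain by objects that move up one degree at a time,
  and an object of \<open>D\<^sup>\<le>\<^sup>-\<^sup>k\<close> can move up \<open>k\<close> times before it leaves \<open>D\<^sup>\<le>\<^sup>0\<close>.
\<close>

lemma iterated_factor_of_aisle:
  assumes \<X>: "subcat D \<X>"
  shows "\<lbrakk>Z \<in> aisle (- int k); Z \<in> coaisle m\<rbrakk> \<Longrightarrow> iterated_factor D (t_interval D U V m 0) \<X> k Z"
proof (induction k arbitrary: Z)
  case 0
  then show ?case by (simp add: t_interval_def)
next
  case (Suc k)
  obtain Z' where Z': "Z' \<in> aisle (- int (Suc k) + 1)" "iso_objects D (ShO D Z') Z"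
    using aisle_unshift[OF Suc.prems(1)] .
  have Z'_Obj: "Z' \<in> Obj D" using Z' trunc_Obj by blast
  then have "Z' \<in> coaisle (m + 1)"
    using coaisle_unshift_mem[OF _ Z'(2) Suc.prems(2)] by blast
  then have "iterated_factor D (t_interval D U V m 0) \<X> k Z'"
    using Suc.IH Z' coaisle_step by auto
  moreover obtain N where N: "N \<in> \<X>" "zero_object D N" using \<X> unfolding subcat_def by blast
  have "tri D Z' N Z"
    using tri_iso[OF tri_zero_mid[OF Z'_Obj N(2)] iso_refl iso_refl Z'(2)] Z'_Obj zero_object_Obj[OF N(2)]
    by blast
  moreover have "Z \<in> t_interval D U V m 0"
    using Suc.prems aisle_mono[of "- int (Suc k)" 0] unfolding t_interval_def by auto
  ultimately show ?case using N by auto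
qed

context
  fixes d :: nat and \<X> :: "'o set"
  assumes d: "d \<ge> 1" and FAE: "d_FAE_closed D U V d \<X>"
begin

lemma subcat_X: "subcat D \<X>" and ext_closed_X: "ext_closed D \<X>"
  and X_aisle: "\<X> \<subseteq> aisle 0" and X_coaisle: "\<X> \<subseteq> coaisle (1 - int d)"
  using FAE unfolding d_FAE_closed_def t_interval_def by (auto simp: algebra_simps)

lemma factor_mem: "iterated_factor D (t_interval D U V (1 - int d) 0) \<X> d Z \<Longrightarrow> Z \<in> \<X>"
  using FAE d_factor_iff_iterated_factor[of D U V d \<X> Z] unfolding d_FAE_closed_def by simp

text \<open>
  The fibre \<open>K' = K[-1]\<close> of \<open>X \<rightarrow> W\<close> lies in \<open>D\<^sup>\<le>\<^sup>-\<^sup>d\<^sup>+\<^sup>1\<close> by assumption on \<open>K\<close>, and in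
  \<open>D\<^sup>\<ge>\<^sup>-\<^sup>d\<^sup>+\<^sup>1\<close> as an extension of \<open>X\<close> by \<open>W[-1]\<close>. So a chain starting at \<open>W\<close> with middle term \<open>X\<close>
  can be continued for up to \<open>d - 1\<close> further steps.
\<close>

lemma fibre_iterated_factor:
  assumes t: "tri D X W K" and X: "X \<in> \<X>" and W: "W \<in> coaisle (1 - int d)"
    and K: "K \<in> aisle (- int d)" and k: "k < d"
  shows "\<exists>K'. tri D K' X W \<and> iterated_factor D (t_interval D U V (1 - int d) 0) \<X> k K'"
proof -
  obtain K' where K': "K' \<in> aisle (- int d + 1)" "iso_objects D (ShO D K') K"
    using aisle_unshift[OF K] .
  obtain W' where W': "W' \<in> coaisle (1 - int d + 1)" "iso_objects D (ShO D W') W"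
    using coaisle_unshift[OF W] .
  have t': "tri D K' X W" using tri_rotate_back[OF t _ K'(2)] K' trunc_Obj by blast
  then have "tri D W' K' X" using tri_rotate_back[OF t' _ W'(2)] W' trunc_Obj by blast
  then have "K' \<in> coaisle (1 - int d)"
    using coaisle_ext W' coaisle_step X X_coaisle by blast
  moreover have "K' \<in> aisle (- int k)" using K' k aisle_mono[of "- int d + 1" "- int k"] by auto
  ultimately show ?thesis using t' iterated_factor_of_aisle[OF subcat_X] by blast
qed

text \<open>
  Let \<open>Z\<close> be an extension of \<open>A\<close> in \<open>D\<^sup>\<le>\<^sup>-\<^sup>d\<close> by \<open>X\<close>, and \<open>W\<close> its upper part. By the octahedral axiom
  the cone \<open>K\<close> of \<open>X \<rightarrow> Z \<rightarrow> W\<close> is an extension of \<open>T[1]\<close> by \<open>A\<close>, hence lies in \<open>D\<^sup>\<le>\<^sup>-\<^sup>d\<close>, and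
  \<open>K[-1] \<rightarrow> X \<rightarrow> W\<close> is the first triangle exhibiting \<open>W\<close> as a d-factor.
\<close>

lemma ext_prod_X_aisle_subset:
  "ext_prod D \<X> (aisle (- int d)) \<subseteq> ext_prod D (aisle (- int d)) \<X>"
proof
  fix Z assume "Z \<in> ext_prod D \<X> (aisle (- int d))"
  then obtain X A where X: "X \<in> \<X>" and A: "A \<in> aisle (- int d)" and t: "tri D X Z A"
    unfolding ext_prod_iff by blast
  obtain T W where tw: "T \<in> aisle (- int d)" "W \<in> coaisle (- int d + 1)" "tri D T Z W"
    using truncation_triangle tri_Obj[OF t] by blast
  then have W: "W \<in> coaisle (1 - int d)" by simp
  obtain K where K: "tri D X W K" "tri D A K (ShO D T)"
    using tri_assoc_right[OF t tri_rotate[OF tw(3)]] by blast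
  have T1: "ShO D T \<in> aisle (- int d)" using shift_mem_aisle tw by blast
  then have Kd: "K \<in> aisle (- int d)" using aisle_ext K(2) A by blast
  then have "W \<in> aisle 0" using aisle_ext[OF K(1)] X X_aisle aisle_mono[of "- int d" 0] by auto
  then have "W \<in> t_interval D U V (1 - int d) 0" using W unfolding t_interval_def by blast
  moreover obtain K' where "tri D K' X W"
      "iterated_factor D (t_interval D U V (1 - int d) 0) \<X> (d - 1) K'"
    using fibre_iterated_factor[OF K(1) X W Kd, of "d - 1"] d by auto
  ultimately have "iterated_factor D (t_interval D U V (1 - int d) 0) \<X> (Suc (d - 1)) W"
    using X by auto
  then have "W \<in> \<X>" using factor_mem d by simp
  then show "Z \<in> ext_prod D (aisle (- int d)) \<X>" unfolding ext_prod_iff using tw by blast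
qed

text \<open>
  The upper part \<open>W\<close> of \<open>X[1]\<close> lies in \<open>D\<^sup>\<le>\<^sup>-\<^sup>1\<close>, so a chain can begin with \<open>W[-1] \<rightarrow> 0 \<rightarrow> W\<close>. Its
  second triangle is \<open>T[-1] \<rightarrow> X \<rightarrow> W[-1]\<close>, which is the truncation of \<open>X[1]\<close> rotated and shifted
  back. For \<open>d = 1\<close> there is no second triangle, but then \<open>W[-1] \<rightarrow> 0 \<rightarrow> W\<close> is already enough.
\<close>

lemma shift_X_subset: assumes X: "X \<in> \<X>" shows "ShO D X \<in> ext_prod D (aisle (- int d)) \<X>"
proof -
  let ?I = "t_interval D U V (1 - int d) 0"
  have X_Obj: "X \<in> Obj D" using subcat_X X unfolding subcat_def by blast
  obtain T W where tw: "T \<in> aisle (- int d)" "W \<in> coaisle (- int d + 1)" "tri D T (ShO D X) W"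
    using truncation_triangle ShO_in_Obj[OF X_Obj] by blast
  then have W: "W \<in> coaisle (1 - int d)" by simp
  have T1: "ShO D T \<in> aisle (- int d)" using shift_mem_aisle tw by blast
  have "ShO D X \<in> aisle (-1)" using aisle_shift[of X "-1"] X X_aisle by auto
  moreover have "ShO D T \<in> aisle (-1)" using T1 aisle_mono[of "- int d" "-1"] d by auto
  ultimately have W1: "W \<in> aisle (- int 1)" using aisle_ext tri_rotate[OF tw(3)] by auto
  have "iterated_factor D ?I \<X> d W"
  proof (cases "d = 1")
    case True
    then show ?thesis using iterated_factor_of_aisle[OF subcat_X W1 W] by simp
  next
    case False
    then obtain k where k: "d = Suc (Suc k)" using d by (metis One_nat_def Suc_le_D le_SucE)
    obtain W' where W': "W' \<in> aisle (- int 1 + 1)" "iso_objects D (ShO D W') W"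
      using aisle_unshift[OF W1] .
    have W'_Obj: "W' \<in> Obj D" using W' trunc_Obj by blast
    have "W' \<in> coaisle (1 - int d + 1)"
      using coaisle_unshift_mem[OF W'_Obj W'(2) W] .
    then have W'c: "W' \<in> coaisle (1 - int d)" using coaisle_step by blast
    have "tri D (ShO D X) (ShO D W') (ShO D T)"
      using tri_iso[OF tri_rotate[OF tw(3)] iso_refl iso_sym[OF W'(2)] iso_refl]
        ShO_in_Obj X_Obj tw trunc_Obj by blast
    then have t': "tri D X W' T" using tri_unshift X_Obj W'_Obj tw trunc_Obj by blast
    obtain K' where K': "tri D K' X W'" "iterated_factor D ?I \<X> k K'"
      using fibre_iterated_factor[OF t' X W'c tw(1), of k] k by auto
    then have f: "iterated_factor D ?I \<X> (Suc k) W'"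
      using X W' W'c by (auto simp: t_interval_def)
    obtain N where N: "N \<in> \<X>" "zero_object D N" using subcat_X unfolding subcat_def by blast
    have "tri D W' N W"
      using tri_iso[OF tri_zero_mid[OF W'_Obj N(2)] iso_refl iso_refl W'(2)] W'_Obj N(2)
      by (simp add: zero_object_def)
    moreover have "W \<in> ?I" using W W1 aisle_mono[of "-1" 0] unfolding t_interval_def by auto
    ultimately show ?thesis using f N k by auto
  qed
  then have "W \<in> \<X>" using factor_mem by blast
  then show ?thesis unfolding ext_prod_iff using tw by blast
qed

lemma suspended_ext_prod: "suspended D (ext_prod D (aisle (- int d)) \<X>)"
proof (rule suspendedI)
  let ?C = "ext_prod D (aisle (- int d)) \<X>"
  have A: "subcat D (aisle (- int d))" using subcat_trunc subcat_UV by blast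
  show "subcat D ?C" using subcat_ext_prod A subcat_X by blast
  show ext: "ext_closed D ?C"
    using ext_closed_ext_prod ext_closed_aisle ext_closed_X ext_prod_X_aisle_subset by blast
  fix Z assume "Z \<in> ?C"
  then obtain T X where tx: "T \<in> aisle (- int d)" "X \<in> \<X>" "tri D T Z X"
    unfolding ext_prod_iff by blast
  have "ShO D T \<in> aisle (- int d)" using shift_mem_aisle tx by blast
  then have "ShO D T \<in> ?C" using subset_ext_prod_left[OF A subcat_X] by blast
  then show "ShO D Z \<in> ?C" using ext_closedD[OF ext tri_shift[OF tx(3)]] shift_X_subset tx by blast
qed

lemma ext_prod_subset_U: "ext_prod D (aisle (- int d)) \<X> \<subseteq> U"
proof -
  have "ext_prod D (aisle (- int d)) \<X> \<subseteq> ext_prod D (aisle 0) (aisle 0)"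
    using aisle_mono[of "- int d" 0] X_aisle by (intro ext_prod_mono) auto
  then show ?thesis using ext_closed_aisle[of 0] aisle_0 unfolding ext_closed_def by auto
qed

lemma aisle_subset_ext_prod: "aisle (- int d) \<subseteq> ext_prod D (aisle (- int d)) \<X>"
  using subset_ext_prod_left subcat_trunc subcat_UV subcat_X by blast

text \<open>
  Rotating \<open>T \<rightarrow> Z \<rightarrow> X\<close> presents \<open>T\<close> as an extension of \<open>Z\<close> by \<open>X[-1]\<close>, both in
  \<open>D\<^sup>\<ge>\<^sup>-\<^sup>d\<^sup>+\<^sup>1\<close>, while \<open>T\<close> is in \<open>D\<^sup>\<le>\<^sup>-\<^sup>d\<close>; so \<open>T\<close> is zero and \<open>Z \<cong> X\<close>.
\<close>

lemma Int_ext_prod_eq: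
  "ext_prod D (aisle (- int d)) \<X> \<inter> t_interval D U V (- int d + 1) 0 = \<X>"
proof
  show "ext_prod D (aisle (- int d)) \<X> \<inter> t_interval D U V (- int d + 1) 0 \<subseteq> \<X>"
  proof
    fix Z assume Z: "Z \<in> ext_prod D (aisle (- int d)) \<X> \<inter> t_interval D U V (- int d + 1) 0"
    then obtain T X where tx: "T \<in> aisle (- int d)" "X \<in> \<X>" "tri D T Z X"
      unfolding Int_iff ext_prod_iff by blast
    obtain X' where X': "X' \<in> coaisle (1 - int d + 1)" "iso_objects D (ShO D X') X"
      using coaisle_unshift[of X] tx X_coaisle by blast
    have "tri D X' T Z" using tri_rotate_back[OF tx(3) _ X'(2)] X' trunc_Obj by blast
    moreover have "Z \<in> coaisle (1 - int d)" using Z unfolding t_interval_def by simp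
    moreover have "X' \<in> coaisle (1 - int d)" using X' coaisle_step by blast
    ultimately have "T \<in> coaisle (1 - int d)" using coaisle_ext by blast
    then have "zero_object D T" using zero_object_if_aisle_coaisle[OF tx(1)] by simp
    then show "Z \<in> \<X>" using tri_first_zero_imp_iso tx iso_sym subcat_iso subcat_X by blast
  qed
  have "\<X> \<subseteq> ext_prod D (aisle (- int d)) \<X>"
    using subset_ext_prod_right subcat_trunc subcat_UV subcat_X by blast
  then show "\<X> \<subseteq> ext_prod D (aisle (- int d)) \<X> \<inter> t_interval D U V (- int d + 1) 0"
    using FAE unfolding d_FAE_closed_def by blast
qed

end

end


section \<open>The correspondence\<close>

theorem proposition3p5:
  fixes D :: "('o, 'a) tricat" and U V :: "'o set" and d :: nat
  assumes "triangulated_cat D"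
    and "bounded_t_structure D U V"
    and "d \<ge> 1"
  defines "FAE \<equiv> {\<X>. d_FAE_closed D U V d \<X>}"
    and "Susp \<equiv> {\<C>. suspended D \<C> \<and> trunc D U (- int d) \<subseteq> \<C> \<and> \<C> \<subseteq> U}"
    and "F \<equiv> \<lambda>\<X>. ext_prod D (trunc D U (- int d)) \<X>"
    and "G \<equiv> \<lambda>\<C>. \<C> \<inter> t_interval D U V (- int d + 1) 0"
  shows "bij_betw F FAE Susp \<and> bij_betw G Susp FAE \<and>
    (\<forall>\<X> \<in> FAE. G (F \<X>) = \<X>) \<and> (\<forall>\<C> \<in> Susp. F (G \<C>) = \<C>)"
proof -
  interpret triangulated_cat D by fact
  interpret t_structured_cat D U V
    by unfold_locales (use assms(2) in \<open>simp add: bounded_t_structure_def\<close>)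
  have GF: "\<forall>\<X> \<in> FAE. G (F \<X>) = \<X>"
    unfolding FAE_def F_def G_def using Int_ext_prod_eq[OF assms(3)] by blast
  have FG: "\<forall>\<C> \<in> Susp. F (G \<C>) = \<C>"
    unfolding Susp_def F_def G_def using ext_prod_Int_eq by blast
  have F: "F ` FAE \<subseteq> Susp"
    unfolding FAE_def Susp_def F_def
    using suspended_ext_prod[OF assms(3)] aisle_subset_ext_prod[OF assms(3)]
      ext_prod_subset_U[OF assms(3)] by blast
  have G: "G ` Susp \<subseteq> FAE"
    unfolding FAE_def Susp_def G_def using d_FAE_closed_Int by blast
  show ?thesis
    using bij_betw_byWitness[OF GF FG F G] bij_betw_byWitness[OF FG GF G F] GF FG by blast
qed

end
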